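(* For a complete first-order theory $T$ the following are equivalent: (1) $T$ is amenable; (2) $T$ has the definable elementary embedding convex Ramsey property (DEECRP); (3) $T$ has the strong DEECRP.
   Context: Let $\mathfrak{C}$ be a monster model of $T$. $T$ is amenable if for every complete type $p\in S(\emptyset)$ in finitely many variables there is an $\mathrm{Aut}(\mathfrak{C})$-invariant regular Borel probability measure on $S_p(\mathfrak{C})$, the space of global types extending $p$ (equivalently, an invariant finitely additive probability measure on its clopen sets). For a finite tuple $\bar a$ and $C\subseteq\mathfrak{C}$ (or a tuple viewed as a set), $\binom{C}{\bar a}$ is the set of tuples $\bar a'$ from $C$ with $\bar a'\equiv\bar a$. A coloring $c:\binom{\mathfrak{C}}{\bar a}\to 2^n$ is definable if there are formulae with parameters $\varphi_i(\bar x)$, $i<n$, with $c(\bar a')(i)=1$ iff $\models\varphi_i(\bar a')$. $T$ has DEECRP if for every $\epsilon>0$, all finite tuples $\bar a\subseteq\bar b\subseteq\mathfrak{C}$, every $n<\omega$ and every definable coloring $c:\binom{\mathfrak{C}}{\bar a}\to 2^n$, there are $k<\omega$, $\lambda_0,\dots,\lambda_{k-1}\in[0,1]$ with $\sum_j\lambda_j=1$, and $\sigma_0,\dots,\sigma_{k-1}\in\mathrm{Aut}(\mathfrak{C})$ such that for all $\bar a',\bar a''\in\binom{\bar b}{\bar a}$: $\max_{i<n}\left|\sum_{j<k}\lambda_jc(\sigma_j(\bar a'))(i)-\sum_{j<k}\lambda_jc(\sigma_j(\bar a''))(i)\right|\le\epsilon$. $T$ has strong DEECRP if the same holds with $\epsilon=0$.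 *)

theory Defs
  imports "HOL-Probability.Probability"
begin

unbundle cardinal_syntax

section \<open>First-order syntax and semantics\<close>

record ('f, 'r) language =
  Funs :: "'f set"
  Rels :: "'r set"
  farity :: "'f \<Rightarrow> nat"
  rarity :: "'r \<Rightarrow> nat"

datatype 'f tm = Var nat | App 'f "'f tm list"

text \<open>Variables are de Bruijn indices: \<open>Exists \<phi>\<close> binds index 0 of \<open>\<phi>\<close>.\<close>

datatype ('f, 'r) fm =
    Equal "'f tm" "'f tm"
  | Rel 'r "'f tm list"
  | Neg "('f, 'r) fm"
  | Conj "('f, 'r) fm" "('f, 'r) fm"
  | Exists "('f, 'r) fm"

fun fv_tm :: "'f tm \<Rightarrow> nat set" where
  "fv_tm (Var i) = {i}"
| "fv_tm (App f ts) = (\<Union>t\<in>set ts. fv_tm t)"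

fun fv :: "('f, 'r) fm \<Rightarrow> nat set" where
  "fv (Equal s t) = fv_tm s \<union> fv_tm t"
| "fv (Rel r ts) = (\<Union>t\<in>set ts. fv_tm t)"
| "fv (Neg \<phi>) = fv \<phi>"
| "fv (Conj \<phi> \<psi>) = fv \<phi> \<union> fv \<psi>"
| "fv (Exists \<phi>) = {i. Suc i \<in> fv \<phi>}"

fun wf_tm :: "('f, 'r) language \<Rightarrow> 'f tm \<Rightarrow> bool" where
  "wf_tm L (Var i) = True"
| "wf_tm L (App f ts) = (f \<in> Funs L \<and> length ts = farity L f \<and> (\<forall>t\<in>set ts. wf_tm L t))"

fun wf_fm :: "('f, 'r) language \<Rightarrow> ('f, 'r) fm \<Rightarrow> bool" where
  "wf_fm L (Equal s t) = (wf_tm L s \<and> wf_tm L t)"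
| "wf_fm L (Rel r ts) = (r \<in> Rels L \<and> length ts = rarity L r \<and> (\<forall>t\<in>set ts. wf_tm L t))"
| "wf_fm L (Neg \<phi>) = wf_fm L \<phi>"
| "wf_fm L (Conj \<phi> \<psi>) = (wf_fm L \<phi> \<and> wf_fm L \<psi>)"
| "wf_fm L (Exists \<phi>) = wf_fm L \<phi>"

definition formulas :: "('f, 'r) language \<Rightarrow> nat \<Rightarrow> ('f, 'r) fm set" where
  "formulas L n = {\<phi>. wf_fm L \<phi> \<and> fv \<phi> \<subseteq> {..<n}}"

definition sentences :: "('f, 'r) language \<Rightarrow> ('f, 'r) fm set" where
  "sentences L = formulas L 0"

record ('f, 'r, 'm) fo_struct =
  dom :: "'m set"
  fint :: "'f \<Rightarrow> 'm list \<Rightarrow> 'm"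
  rint :: "'r \<Rightarrow> 'm list \<Rightarrow> bool"

definition is_struct :: "('f, 'r) language \<Rightarrow> ('f, 'r, 'm) fo_struct \<Rightarrow> bool" where
  "is_struct L M \<longleftrightarrow> dom M \<noteq> {} \<and>
     (\<forall>f\<in>Funs L. \<forall>xs. set xs \<subseteq> dom M \<and> length xs = farity L f \<longrightarrow> fint M f xs \<in> dom M)"

fun val :: "('f, 'r, 'm) fo_struct \<Rightarrow> (nat \<Rightarrow> 'm) \<Rightarrow> 'f tm \<Rightarrow> 'm" where
  "val M e (Var i) = e i"
| "val M e (App f ts) = fint M f (map (val M e) ts)"

fun sat :: "('f, 'r, 'm) fo_struct \<Rightarrow> (nat \<Rightarrow> 'm) \<Rightarrow> ('f, 'r) fm \<Rightarrow> bool" where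
  "sat M e (Equal s t) \<longleftrightarrow> val M e s = val M e t"
| "sat M e (Rel r ts) \<longleftrightarrow> rint M r (map (val M e) ts)"
| "sat M e (Neg \<phi>) \<longleftrightarrow> \<not> sat M e \<phi>"
| "sat M e (Conj \<phi> \<psi>) \<longleftrightarrow> sat M e \<phi> \<and> sat M e \<psi>"
| "sat M e (Exists \<phi>) \<longleftrightarrow> (\<exists>a\<in>dom M. sat M (case_nat a e) \<phi>)"

text \<open>\<open>holds M \<phi> xs\<close> is only used for \<open>\<phi> \<in> formulas L (length xs)\<close>, so that the unspecified
  value of \<open>xs ! i\<close> beyond the end of the list plays no role.\<close>

definition holds :: "('f, 'r, 'm) fo_struct \<Rightarrow> ('f, 'r) fm \<Rightarrow> 'm list \<Rightarrow> bool" where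
  "holds M \<phi> xs \<longleftrightarrow> sat M (\<lambda>i. xs ! i) \<phi>"

definition is_model :: "('f, 'r) language \<Rightarrow> ('f, 'r) fm set \<Rightarrow> ('f, 'r, 'm) fo_struct \<Rightarrow> bool" where
  "is_model L T M \<longleftrightarrow> is_struct L M \<and> (\<forall>\<phi>\<in>T. holds M \<phi> [])"

text \<open>A formula of HOL cannot quantify over structures on all types. By the downward
  Loewenheim-Skolem theorem, every model of a set of \<open>L\<close>-sentences is elementarily equivalent to
  one of cardinality at most that of the set of \<open>L\<close>-formulas, so models whose domain
  is a set of formulas suffice to determine consistency and entailment.\<close>

definition consistent :: "('f, 'r) language \<Rightarrow> ('f, 'r) fm set \<Rightarrow> bool" where
  "consistent L T \<longleftrightarrow> (\<exists>N :: ('f, 'r, ('f, 'r) fm) fo_struct. is_model L T N)"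

definition entails :: "('f, 'r) language \<Rightarrow> ('f, 'r) fm set \<Rightarrow> ('f, 'r) fm \<Rightarrow> bool" where
  "entails L T \<phi> \<longleftrightarrow>
     (\<forall>N :: ('f, 'r, ('f, 'r) fm) fo_struct. is_model L T N \<longrightarrow> holds N \<phi> [])"

definition complete_theory :: "('f, 'r) language \<Rightarrow> ('f, 'r) fm set \<Rightarrow> bool" where
  "complete_theory L T \<longleftrightarrow> T \<subseteq> sentences L \<and> consistent L T \<and>
     (\<forall>\<phi>\<in>sentences L. entails L T \<phi> \<or> entails L T (Neg \<phi>))"

section \<open>Parameters and types\<close>

text \<open>The language \<open>L(A)\<close> has an additional constant symbol \<open>Inr a\<close>, naming \<open>a\<close>, for each
  \<open>a \<in> A\<close>.\<close>

definition lang_over :: "('f, 'r) language \<Rightarrow> 'm set \<Rightarrow> ('f + 'm, 'r) language" where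
  "lang_over L A = \<lparr>Funs = Inl ` Funs L \<union> Inr ` A, Rels = Rels L,
     farity = case_sum (farity L) (\<lambda>_. 0), rarity = rarity L\<rparr>"

definition struct_over :: "('f, 'r, 'm) fo_struct \<Rightarrow> ('f + 'm, 'r, 'm) fo_struct" where
  "struct_over M = \<lparr>dom = dom M, fint = case_sum (fint M) (\<lambda>a _. a), rint = rint M\<rparr>"

definition tp :: "('f, 'r) language \<Rightarrow> ('f, 'r, 'm) fo_struct \<Rightarrow> 'm set \<Rightarrow> 'm list
    \<Rightarrow> ('f + 'm, 'r) fm set" where
  "tp L M A xs = {\<phi> \<in> formulas (lang_over L A) (length xs). holds (struct_over M) \<phi> xs}"

text \<open>\<open>types L M n A\<close> is \<open>S\<^sub>n(A)\<close>: the complete \<open>n\<close>-types over \<open>A\<close>, as sets of \<open>L(A)\<close>-formulas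
  finitely satisfiable in \<open>M\<close>.\<close>

definition types :: "('f, 'r) language \<Rightarrow> ('f, 'r, 'm) fo_struct \<Rightarrow> nat \<Rightarrow> 'm set
    \<Rightarrow> ('f + 'm, 'r) fm set set" where
  "types L M n A = {p. p \<subseteq> formulas (lang_over L A) n \<and>
     (\<forall>F. finite F \<and> F \<subseteq> p \<longrightarrow>
        (\<exists>xs. length xs = n \<and> set xs \<subseteq> dom M \<and> (\<forall>\<phi>\<in>F. holds (struct_over M) \<phi> xs))) \<and>
     (\<forall>\<phi>\<in>formulas (lang_over L A) n. \<phi> \<in> p \<or> Neg \<phi> \<in> p)}"

section \<open>Monster models\<close>

definition Aut :: "('f, 'r) language \<Rightarrow> ('f, 'r, 'm) fo_struct \<Rightarrow> ('m \<Rightarrow> 'm) set" where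
  "Aut L M = {\<sigma>. bij_betw \<sigma> (dom M) (dom M) \<and>
     (\<forall>f\<in>Funs L. \<forall>xs. set xs \<subseteq> dom M \<and> length xs = farity L f \<longrightarrow>
        \<sigma> (fint M f xs) = fint M f (map \<sigma> xs)) \<and>
     (\<forall>r\<in>Rels L. \<forall>xs. set xs \<subseteq> dom M \<and> length xs = rarity L r \<longrightarrow>
        rint M r xs = rint M r (map \<sigma> xs))}"

definition partial_elementary ::
    "('f, 'r) language \<Rightarrow> ('f, 'r, 'm) fo_struct \<Rightarrow> 'm set \<Rightarrow> ('m \<Rightarrow> 'm) \<Rightarrow> bool" where
  "partial_elementary L M A f \<longleftrightarrow> A \<subseteq> dom M \<and> f ` A \<subseteq> dom M \<and>
     (\<forall>xs. set xs \<subseteq> A \<longrightarrow> (\<forall>\<phi>\<in>formulas L (length xs). holds M \<phi> xs = holds M \<phi> (map f xs)))"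

definition saturated :: "('f, 'r) language \<Rightarrow> 'k rel \<Rightarrow> ('f, 'r, 'm) fo_struct \<Rightarrow> bool" where
  "saturated L \<kappa> M \<longleftrightarrow> (\<forall>A n. A \<subseteq> dom M \<and> |A| <o \<kappa> \<longrightarrow>
     (\<forall>p\<in>types L M n A. \<exists>xs. length xs = n \<and> set xs \<subseteq> dom M \<and> tp L M A xs = p))"

definition strongly_homogeneous ::
    "('f, 'r) language \<Rightarrow> 'k rel \<Rightarrow> ('f, 'r, 'm) fo_struct \<Rightarrow> bool" where
  "strongly_homogeneous L \<kappa> M \<longleftrightarrow> (\<forall>A f. |A| <o \<kappa> \<and> partial_elementary L M A f \<longrightarrow>
     (\<exists>\<sigma>\<in>Aut L M. \<forall>a\<in>A. \<sigma> a = f a))"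

text \<open>The set of \<open>L\<close>-formulas has cardinality \<open>|L| + \<aleph>\<^sub>0\<close>, so \<open>\<kappa>\<close> is uncountable.\<close>

definition monster_model :: "('f, 'r) language \<Rightarrow> ('f, 'r) fm set \<Rightarrow> 'k rel
    \<Rightarrow> ('f, 'r, 'm) fo_struct \<Rightarrow> bool" where
  "monster_model L T \<kappa> M \<longleftrightarrow> is_model L T M \<and> Card_order \<kappa> \<and> |{\<phi>. wf_fm L \<phi>}| <o \<kappa> \<and>
     saturated L \<kappa> M \<and> strongly_homogeneous L \<kappa> M"

section \<open>Amenability\<close>

definition global_types :: "('f, 'r) language \<Rightarrow> ('f, 'r, 'm) fo_struct \<Rightarrow> nat
    \<Rightarrow> ('f + 'm, 'r) fm set \<Rightarrow> ('f + 'm, 'r) fm set set" where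
  "global_types L M n p = {q \<in> types L M n (dom M). p \<subseteq> q}"

definition type_space :: "('f, 'r) language \<Rightarrow> ('f, 'r, 'm) fo_struct \<Rightarrow> nat
    \<Rightarrow> ('f + 'm, 'r) fm set \<Rightarrow> ('f + 'm, 'r) fm set topology" where
  "type_space L M n p = topology_generated_by
     {{q \<in> global_types L M n p. \<phi> \<in> q} | \<phi>. \<phi> \<in> formulas (lang_over L (dom M)) n}"

text \<open>An automorphism acts on global types by acting on the parameters of formulas.\<close>

definition act :: "('m \<Rightarrow> 'm) \<Rightarrow> ('f + 'm, 'r) fm set \<Rightarrow> ('f + 'm, 'r) fm set" where
  "act \<sigma> q = map_fm (map_sum id \<sigma>) id ` q"

definition regular_borel_prob :: "'a topology \<Rightarrow> 'a measure \<Rightarrow> bool" where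
  "regular_borel_prob X \<mu> \<longleftrightarrow> prob_space \<mu> \<and>
     space \<mu> = topspace X \<and> sets \<mu> = sigma_sets (topspace X) {U. openin X U} \<and>
     (\<forall>B\<in>sets \<mu>.
        emeasure \<mu> B = (INF U\<in>{U. openin X U \<and> B \<subseteq> U}. emeasure \<mu> U) \<and>
        emeasure \<mu> B = (SUP K\<in>{K. compactin X K \<and> K \<subseteq> B}. emeasure \<mu> K))"

definition amenable :: "('f, 'r) language \<Rightarrow> ('f, 'r, 'm) fo_struct \<Rightarrow> bool" where
  "amenable L M \<longleftrightarrow> (\<forall>n. \<forall>p\<in>types L M n {}. \<exists>\<mu>.
     regular_borel_prob (type_space L M n p) \<mu> \<and>
     (\<forall>\<sigma>\<in>Aut L M. \<forall>B\<in>sets \<mu>. emeasure \<mu> (act \<sigma> ` B) = emeasure \<mu> B))"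

section \<open>The convex Ramsey properties\<close>

definition copies :: "('f, 'r) language \<Rightarrow> ('f, 'r, 'm) fo_struct \<Rightarrow> 'm set \<Rightarrow> 'm list
    \<Rightarrow> 'm list set" where
  "copies L M B a = {a'. set a' \<subseteq> B \<and> length a' = length a \<and> tp L M {} a' = tp L M {} a}"

definition definable_coloring :: "('f, 'r) language \<Rightarrow> ('f, 'r, 'm) fo_struct \<Rightarrow> 'm list \<Rightarrow> nat
    \<Rightarrow> ('m list \<Rightarrow> nat \<Rightarrow> nat) \<Rightarrow> bool" where
  "definable_coloring L M a n c \<longleftrightarrow>
     c \<in> copies L M (dom M) a \<rightarrow> ({..<n} \<rightarrow> {0, 1}) \<and>
     (\<exists>\<phi>. \<forall>i<n. \<phi> i \<in> formulas (lang_over L (dom M)) (length a) \<and>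
        (\<forall>a'\<in>copies L M (dom M) a. c a' i = 1 \<longleftrightarrow> holds (struct_over M) (\<phi> i) a'))"

definition convex_ramsey :: "real \<Rightarrow> ('f, 'r) language \<Rightarrow> ('f, 'r, 'm) fo_struct \<Rightarrow> bool" where
  "convex_ramsey \<epsilon> L M \<longleftrightarrow>
     (\<forall>a b n c. set a \<subseteq> set b \<and> set b \<subseteq> dom M \<and> definable_coloring L M a n c \<longrightarrow>
        (\<exists>(k::nat) (w :: nat \<Rightarrow> real) \<sigma>.
           (\<forall>j<k. w j \<in> {0..1}) \<and> (\<Sum>j<k. w j) = 1 \<and> (\<forall>j<k. \<sigma> j \<in> Aut L M) \<and>
           (\<forall>a'\<in>copies L M (set b) a. \<forall>a''\<in>copies L M (set b) a. \<forall>i<n.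
              \<bar>(\<Sum>j<k. w j * real (c (map (\<sigma> j) a') i)) -
               (\<Sum>j<k. w j * real (c (map (\<sigma> j) a'') i))\<bar> \<le> \<epsilon>)))"

definition DEECRP :: "('f, 'r) language \<Rightarrow> ('f, 'r, 'm) fo_struct \<Rightarrow> bool" where
  "DEECRP L M \<longleftrightarrow> (\<forall>\<epsilon>>0. convex_ramsey \<epsilon> L M)"

definition strong_DEECRP :: "('f, 'r) language \<Rightarrow> ('f, 'r, 'm) fo_struct \<Rightarrow> bool" where
  "strong_DEECRP L M \<longleftrightarrow> convex_ramsey 0 L M"

end

theory Submission
  imports Defs
begin

text \<open>
  Everything rests on exchanging variables and parameters: for \<open>\<phi>(x; d)\<close> and an automorphism \<open>\<tau>\<close>,
  \<open>\<phi>(\<tau>\<^sup>-\<^sup>1 a; d)\<close> holds iff \<open>\<phi>(a; \<tau> d)\<close> does.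

  If \<open>T\<close> is amenable and a coloring of the copies of \<open>a\<close> is given by formulas \<open>\<phi>\<^sub>i(x; d)\<close>, take an
  invariant measure on the global extensions of \<open>tp(d)\<close>. By invariance the measure of
  \<open>\<phi>\<^sub>i(a'; z)\<close> is the same for all copies \<open>a'\<close> of \<open>a\<close>. The finitely many sets \<open>\<phi>\<^sub>i(a'; z)\<close>, for
  \<open>a'\<close> in \<open>b\<close>, generate finitely many atoms; each nonempty atom contains some \<open>\<tau> d\<close>, and \<open>\<tau>\<^sup>-\<^sup>1\<close>
  weighted by the measure of the atom yields the strong DEECRP.

  Conversely, let \<open>a\<close> realise \<open>p\<close>. The DEECRP for the coloring \<open>z \<mapsto> \<phi>\<^sub>i(a; z)\<close> of the copies of \<open>d\<close>
  and a tuple \<open>b\<close> that contains \<open>d\<close> and finitely many \<open>\<sigma> d\<close> gives a convex combination of the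
  points \<open>\<tau>\<^sub>j\<^sup>-\<^sup>1 a\<close> that is almost invariant under these \<open>\<sigma>\<close> on the sets \<open>\<phi>\<^sub>i(x; d)\<close>. By
  compactness of a product of unit intervals there is an exactly invariant content on definable
  sets. On a Stone space a content on the clopen algebra extends to a regular Borel measure,
  through the outer measure that is determined by its values on open sets.
\<close>

section \<open>Regular Borel measures on Stone spaces\<close>

text \<open>An algebra contains complements, so the sets in \<open>\<A>\<close> are clopen:
  \<open>X\<close> is a compact space with a clopen base, and \<open>f\<close> is a finitely
  additive probability on that base. Values lie in \<open>ennreal\<close>, where suprema and infima
  exist without side conditions.\<close>

locale stone_content = algebra "topspace X" \<A> for X :: "'a topology" and \<A> +
  fixes f :: "'a set \<Rightarrow> ennreal"
  assumes compact: "compact_space X"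
    and open_base: "A \<in> \<A> \<Longrightarrow> openin X A"
    and base: "openin X U \<Longrightarrow> x \<in> U \<Longrightarrow> \<exists>A\<in>\<A>. x \<in> A \<and> A \<subseteq> U"
    and f_empty: "f {} = 0"
    and f_Un: "A \<in> \<A> \<Longrightarrow> B \<in> \<A> \<Longrightarrow> A \<inter> B = {} \<Longrightarrow> f (A \<union> B) = f A + f B"
    and f_top: "f (topspace X) = 1"
begin

text \<open>Meant for open \<open>U\<close>: every compact subset of \<open>U\<close> lies in a
  clopen one, so an inner regular extension of \<open>f\<close> can have no other value on
  \<open>U\<close>.\<close>

definition inner :: "'a set \<Rightarrow> ennreal" where
  "inner U = (SUP A\<in>{A\<in>\<A>. A \<subseteq> U}. f A)"

text \<open>Builds outer regularity into the construction from the start.\<close>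

definition outer :: "'a set \<Rightarrow> ennreal" where
  "outer B = (INF U\<in>{U. openin X U \<and> B \<subseteq> U}. inner U)"

lemma base_compactin: "A \<in> \<A> \<Longrightarrow> compactin X A"
proof -
  assume A: "A \<in> \<A>"
  then have "topspace X - A \<in> \<A>" by auto
  then have "closedin X A"
    using A open_base sets_into_space by (auto simp: closedin_def)
  then show ?thesis using compact closedin_compact_space by blast
qed

lemma f_mono: "A \<in> \<A> \<Longrightarrow> B \<in> \<A> \<Longrightarrow> A \<subseteq> B \<Longrightarrow> f A \<le> f B"
proof -
  assume "A \<in> \<A>" "B \<in> \<A>" "A \<subseteq> B"
  then have "f (A \<union> (B - A)) = f A + f (B - A)" by (intro f_Un) auto
  moreover have "A \<union> (B - A) = B" using \<open>A \<subseteq> B\<close> by auto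
  ultimately show ?thesis by simp
qed

section \<open>Subadditivity on open sets\<close>

lemma inner_mono: "U \<subseteq> V \<Longrightarrow> inner U \<le> inner V"
  unfolding inner_def by (rule SUP_subset_mono) auto

lemma f_le_inner: "A \<in> \<A> \<Longrightarrow> A \<subseteq> U \<Longrightarrow> f A \<le> inner U"
  unfolding inner_def by (rule SUP_upper) auto

lemma inner_base: "A \<in> \<A> \<Longrightarrow> inner A = f A"
  by (rule antisym) (auto simp: inner_def intro!: SUP_least f_mono SUP_upper)

lemma inner_le_1: "inner U \<le> 1"
  unfolding inner_def using f_mono[OF _ top] sets_into_space f_top by (auto intro!: SUP_least)

lemma outer_mono: "A \<subseteq> B \<Longrightarrow> outer A \<le> outer B"
  unfolding outer_def by (rule INF_superset_mono) auto

lemma outer_open: "openin X U \<Longrightarrow> outer U = inner U"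
  by (rule antisym) (auto simp: outer_def intro: INF_lower INF_greatest inner_mono)

lemma outer_le_inner: "openin X U \<Longrightarrow> B \<subseteq> U \<Longrightarrow> outer B \<le> inner U"
  unfolding outer_def by (rule INF_lower) auto

text \<open>The basic sets inside \<open>U\<close> cover \<open>K\<close>; finitely many suffice,
  and their union stays in the algebra.\<close>

lemma compact_between:
  assumes K: "compactin X K" and U: "openin X U" and KU: "K \<subseteq> U"
  shows "\<exists>C\<in>\<A>. K \<subseteq> C \<and> C \<subseteq> U"
proof -
  have "K \<subseteq> \<Union>{A\<in>\<A>. A \<subseteq> U}" using base[OF U] KU by blast
  then obtain \<F> where F: "finite \<F>" "\<F> \<subseteq> {A\<in>\<A>. A \<subseteq> U}" "K \<subseteq> \<Union>\<F>"
    using K open_base unfolding compactin_def by (metis (no_types, lifting) mem_Collect_eq)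
  then have "\<Union>\<F> \<in> \<A>" by (intro finite_Union) auto
  then show ?thesis using F by blast
qed

text \<open>For a clopen \<open>A\<close> inside the union, the part of \<open>A\<close> outside
  \<open>V\<close> is compact and lies in \<open>U\<close>, so a clopen set fits between them. It
  cuts \<open>A\<close> into a piece in \<open>U\<close> and a rest in \<open>V\<close>.\<close>

lemma inner_Un:
  assumes U: "openin X U" and V: "openin X V"
  shows "inner (U \<union> V) \<le> inner U + inner V"
proof -
  have "f A \<le> inner U + inner V" if A: "A \<in> \<A>" "A \<subseteq> U \<union> V" for A
  proof -
    have "compactin X (A \<inter> (topspace X - V))"
      using A V by (intro compact_Int_closedin base_compactin) auto
    then obtain C where C: "C \<in> \<A>" "A \<inter> (topspace X - V) \<subseteq> C" "C \<subseteq> U"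
      using compact_between[OF _ U, of "A \<inter> (topspace X - V)"] A(2) by auto
    have "A - C \<subseteq> V" using C A(2) sets_into_space[OF A(1)] by blast
    have "f ((A \<inter> C) \<union> (A - C)) = f (A \<inter> C) + f (A - C)"
      using A C by (intro f_Un) auto
    moreover have "(A \<inter> C) \<union> (A - C) = A" by auto
    ultimately have "f A = f (A \<inter> C) + f (A - C)" by simp
    also have "\<dots> \<le> inner U + inner V"
      using A C \<open>A - C \<subseteq> V\<close> by (intro add_mono f_le_inner) auto
    finally show ?thesis .
  qed
  then show ?thesis unfolding inner_def[of "U \<union> V"] by (auto intro: SUP_least)
qed

lemma inner_UN_finite:
  fixes U :: "nat \<Rightarrow> 'a set"
  assumes "\<And>i. openin X (U i)"
  shows "inner (\<Union>i<n. U i) \<le> (\<Sum>i<n. inner (U i))"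
proof (induction n)
  case 0
  then show ?case using inner_base[of "{}"] f_empty by simp
next
  case (Suc n)
  have "inner (\<Union>i<Suc n. U i) = inner ((\<Union>i<n. U i) \<union> U n)"
    by (simp add: lessThan_Suc Un_commute)
  also have "\<dots> \<le> inner (\<Union>i<n. U i) + inner (U n)"
    using assms by (intro inner_Un) auto
  also have "\<dots> \<le> (\<Sum>i<Suc n. inner (U i))" using Suc by (simp add: add_right_mono)
  finally show ?case .
qed

text \<open>Reduces to the finite case: a clopen subset of the union is compact and so already lies
  in finitely many of the \<open>U i\<close>.\<close>

lemma inner_UN:
  fixes U :: "nat \<Rightarrow> 'a set"
  assumes U: "\<And>i. openin X (U i)"
  shows "inner (\<Union>i. U i) \<le> (\<Sum>i. inner (U i))"
proof -
  have "f A \<le> (\<Sum>i. inner (U i))" if A: "A \<in> \<A>" "A \<subseteq> (\<Union>i. U i)" for A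
  proof -
    obtain \<F> where F: "finite \<F>" "\<F> \<subseteq> range U" "A \<subseteq> \<Union>\<F>"
     
        using base_compactin[OF A(1)] A(2) U unfolding compactin_def by (metis (no_types, lifting) imageE)
    then obtain I where I: "finite I" "\<F> = U ` I" by (meson finite_subset_image)
    then obtain n where n: "I \<subseteq> {..<n}" using finite_nat_iff_bounded by blast
    have "A \<subseteq> (\<Union>i<n. U i)" using F I n by blast
    then have "f A \<le> inner (\<Union>i<n. U i)" using A f_le_inner by blast
    also have "\<dots> \<le> (\<Sum>i<n. inner (U i))" using U by (rule inner_UN_finite)
    also have "\<dots> \<le> (\<Sum>i. inner (U i))" by (rule sum_le_suminf) auto
    finally show ?thesis .
  qed
  then show ?thesis unfolding inner_def[of "\<Union>i. U i"] by (auto intro: SUP_least)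
qed

section \<open>The outer measure\<close>

lemma outer_approx:
  assumes "0 < (e::real)" "B \<subseteq> topspace X"
  shows "\<exists>U. openin X U \<and> B \<subseteq> U \<and> inner U \<le> outer B + e"
proof -
  have "outer B \<le> inner (topspace X)" using assms by (intro outer_le_inner) auto
  then have "outer B \<noteq> \<infinity>" using inner_le_1[of "topspace X"] by (auto simp: top_unique)
  \<comment> \<open>Since \<open>outer B\<close> is finite, adding \<open>e\<close> makes it
    strictly larger, so some member of the infimum lies below the sum.\<close>
  then have "outer B < outer B + e"
    using assms by (simp add: ennreal_add_left_cancel_less[of _ 0, simplified])
  then show ?thesis unfolding outer_def INF_less_iff
    by (auto intro: less_imp_le simp: outer_def[symmetric])
qed

lemma outer_UN:
  fixes B :: "nat \<Rightarrow> 'a set"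
  assumes B: "\<And>i. B i \<subseteq> topspace X"
  shows "outer (\<Union>i. B i) \<le> (\<Sum>i. outer (B i))"
proof (rule ennreal_le_epsilon)
  fix e :: real assume e: "0 < e"
  \<comment> \<open>The tolerances \<open>e * (1/2)^Suc i\<close> add up to exactly
    \<open>e\<close>.\<close>
  have "\<exists>U. openin X U \<and> B i \<subseteq> U \<and> inner U \<le> outer (B i) + ennreal (e * (1/2)^Suc i)" for i
    using e B by (intro outer_approx) auto
  then obtain U where U: "\<And>i. openin X (U i)" "\<And>i. B i \<subseteq> U i"
    "\<And>i. inner (U i) \<le> outer (B i) + ennreal (e * (1/2)^Suc i)" by metis
  have "outer (\<Union>i. B i) \<le> inner (\<Union>i. U i)"
    using U by (intro outer_le_inner) auto
  also have "\<dots> \<le> (\<Sum>i. inner (U i))" using U(1) by (rule inner_UN)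
  also have "\<dots> \<le> (\<Sum>i. outer (B i) + ennreal (e * (1/2)^Suc i))"
    using U by (intro suminf_le) auto
  also have "\<dots> = (\<Sum>i. outer (B i)) + (\<Sum>i. ennreal (e * (1/2)^Suc i))"
    by (rule suminf_add[symmetric]) auto
  also have "(\<Sum>i. ennreal (e * (1/2)^Suc i)) = ennreal e"
    using e sums_mult[OF power_half_series, of e] 
    by (intro suminf_ennreal_eq) (auto simp: ac_simps)
  finally show "outer (\<Union>i. B i) \<le> (\<Sum>i. outer (B i)) + ennreal e" .
qed

lemma outer_empty: "outer {} = 0"
  using outer_open[of "{}"] inner_base[of "{}"] f_empty by simp

lemma outer_measure_space_outer: "outer_measure_space (Pow (topspace X)) outer"
  unfolding outer_measure_space_def positive_def increasing_def countably_subadditive_def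
  using outer_empty outer_mono outer_UN by (auto simp: image_subset_iff)

text \<open>A clopen subset of \<open>V - A\<close> together with \<open>A\<close> is a clopen
  subset of \<open>V\<close>, and adding the constant \<open>f A\<close> commutes with the supremum.
  This is the source of the measurability of open sets.\<close>

lemma inner_split:
  assumes "A \<in> \<A>" "A \<subseteq> V"
  shows "f A + inner (V - A) \<le> inner V"
proof -
  have "f A + f B \<le> inner V" if "B \<in> \<A>" "B \<subseteq> V - A" for B
  proof -
    have "A \<inter> B = {}" "A \<union> B \<in> \<A>" "A \<union> B \<subseteq> V" using assms that by auto
    then show ?thesis
      using f_Un[of A B] f_le_inner[of "A \<union> B" V] assms that by simp
  qed
  moreover have "f A + inner (V - A) = (SUP B\<in>{B\<in>\<A>. B \<subseteq> V - A}. f A + f B)"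
    unfolding inner_def by (rule ennreal_SUP_add_right) auto
  ultimately show ?thesis by (auto intro: SUP_least)
qed

text \<open>The Caratheodory condition is tested on an open \<open>V\<close> around
  \<open>B\<close>. Replacing \<open>V \<inter> U\<close> by a clopen subset \<open>A\<close> keeps
  \<open>V - A\<close> open, so that \<open>inner_split\<close> applies; the supremum over
  \<open>A\<close> and the infimum over \<open>V\<close> then give the hard inequality.\<close>

lemma open_lambda_system:
  assumes U: "openin X U"
  shows "U \<in> lambda_system (topspace X) (Pow (topspace X)) outer"
proof -
  interpret P: sigma_algebra "topspace X" "Pow (topspace X)" by (rule sigma_algebra_Pow)
  have "outer (B \<inter> U) + outer (B - U) = outer B" if B: "B \<subseteq> topspace X" for B
  proof (rule antisym)
    have "outer (B \<inter> U) + outer (B - U) \<le> inner V" if V: "openin X V" "B \<subseteq> V" for V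
    proof -
      have "f A + outer (B - U) \<le> inner V" if A: "A \<in> \<A>" "A \<subseteq> V \<inter> U" for A
      proof -
        have "topspace X - A \<in> \<A>" using A by auto
        then have "openin X (V \<inter> (topspace X - A))" using V open_base by blast
        moreover have "V \<inter> (topspace X - A) = V - A" using V openin_subset by blast
        ultimately have "outer (B - U) \<le> inner (V - A)"
          using A V by (intro outer_le_inner) auto
        then have "f A + outer (B - U) \<le> f A + inner (V - A)" by (rule add_left_mono)
        also have "\<dots> \<le> inner V" using A by (intro inner_split) auto
        finally show ?thesis .
      qed
      moreover have "inner (V \<inter> U) + outer (B - U) =
          (SUP A\<in>{A\<in>\<A>. A \<subseteq> V \<inter> U}. f A + outer (B - U))"
        unfolding inner_def by (rule ennreal_SUP_add_left[symmetric]) auto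
      ultimately have "inner (V \<inter> U) + outer (B - U) \<le> inner V" by (auto intro: SUP_least)
      moreover have "outer (B \<inter> U) \<le> inner (V \<inter> U)"
        using U V by (intro outer_le_inner) auto
      ultimately show ?thesis by (meson add_right_mono order_trans)
    qed
    then show "outer (B \<inter> U) + outer (B - U) \<le> outer B"
      unfolding outer_def[of B] by (auto intro: INF_greatest)
    have "outer ((B \<inter> U) \<union> (B - U)) \<le> outer (B \<inter> U) + outer (B - U)"
    proof (rule subadditiveD[OF P.countably_subadditive_subadditive])
      show "positive (Pow (topspace X)) outer" "countably_subadditive (Pow (topspace X)) outer"
        using outer_measure_space_outer by (simp_all add: outer_measure_space_def)
    qed (use B in auto)
    moreover have "(B \<inter> U) \<union> (B - U) = B" by auto
    ultimately show "outer B \<le> outer (B \<inter> U) + outer (B - U)" by simp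
  qed
  then show ?thesis
    using U openin_subset by (auto simp: P.lambda_system_eq)
qed

section \<open>The Borel extension, its regularity and its symmetries\<close>

definition borel_extension :: "'a measure" where
  "borel_extension = measure_of (topspace X) {U. openin X U} outer"

lemma space_borel_extension: "space borel_extension = topspace X"
  unfolding borel_extension_def by (rule space_measure_of) (auto dest: openin_subset)

lemma sets_borel_extension: "sets borel_extension = sigma_sets (topspace X) {U. openin X U}"
  unfolding borel_extension_def by (rule sets_measure_of) (auto dest: openin_subset)

text \<open>Caratheodory's lemma makes \<open>outer\<close> a measure on its
  \<open>lambda_system\<close>, a sigma algebra that contains the open sets and hence all Borel
  sets.\<close>

lemma emeasure_borel_extension:
  assumes "B \<in> sigma_sets (topspace X) {U. openin X U}"
  shows "emeasure borel_extension B = outer B"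
proof -
  interpret P: sigma_algebra "topspace X" "Pow (topspace X)" by (rule sigma_algebra_Pow)
  let ?L = "lambda_system (topspace X) (Pow (topspace X)) outer"
  have L: "measure_space (topspace X) ?L outer"
    by (rule P.caratheodory_lemma[OF outer_measure_space_outer])
  then interpret L: sigma_algebra "topspace X" ?L by (simp add: measure_space_def)
  have sub: "sigma_sets (topspace X) {U. openin X U} \<subseteq> ?L"
    using open_lambda_system by (intro L.sigma_sets_subset) auto
  show ?thesis
    by (rule emeasure_measure_of[OF borel_extension_def])
      (use L sub assms in \<open>auto simp: sets_borel_extension measure_space_def positive_def
         countably_additive_def dest: openin_subset\<close>)
qed

lemma emeasure_borel_extension_open: "openin X U \<Longrightarrow> emeasure borel_extension U = inner U"
  using emeasure_borel_extension[of U] outer_open by auto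

lemma regular_borel_prob_borel_extension: "regular_borel_prob X borel_extension"
  unfolding regular_borel_prob_def
proof (intro conjI ballI)
  note sp = space_borel_extension and st = sets_borel_extension
  show prob: "prob_space borel_extension"
    by (rule prob_spaceI)
      (simp add: sp emeasure_borel_extension_open inner_base f_top)
  then interpret prob_space borel_extension .
  show "space borel_extension = topspace X" by (rule sp)
  show "sets borel_extension = sigma_sets (topspace X) {U. openin X U}" by (rule st)
  fix B assume B: "B \<in> sets borel_extension"
  then have BX: "B \<subseteq> topspace X" using sets.sets_into_space sp by blast
  have opens: "openin X U \<Longrightarrow> U \<in> sets borel_extension" for U by (simp add: st)
  show "emeasure borel_extension B =
      (INF U\<in>{U. openin X U \<and> B \<subseteq> U}. emeasure borel_extension U)"
    using B emeasure_borel_extension[of B]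
    by (simp add: st emeasure_borel_extension_open outer_def[of B] cong: INF_cong_simp)
  show "emeasure borel_extension B =
      (SUP K\<in>{K. compactin X K \<and> K \<subseteq> B}. emeasure borel_extension K)" (is "_ = ?S")
  proof (rule antisym)
    show "?S \<le> emeasure borel_extension B"
      using B by (auto intro!: SUP_least emeasure_mono)
    show "emeasure borel_extension B \<le> ?S"
    proof (rule ennreal_le_epsilon)
      fix e :: real assume e: "0 < e"
      \<comment> \<open>Inner regularity is outer regularity of the complement: if \<open>V\<close>
        is open around the complement of \<open>B\<close>, then the complement of \<open>V\<close>
        is compact and lies in \<open>B\<close>.\<close>
      have C: "topspace X - B \<in> sets borel_extension" using B sets.compl_sets sp by metis
      obtain V where V: "openin X V" "topspace X - B \<subseteq> V"
        "inner V \<le> outer (topspace X - B) + e"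
        using outer_approx[OF e, of "topspace X - B"] by auto
      have "emeasure borel_extension V \<le> emeasure borel_extension (topspace X - B) + e"
        using V C by (simp add: emeasure_borel_extension_open emeasure_borel_extension st)
      then have "prob V \<le> prob (topspace X - B) + e"
        using e by (simp add: emeasure_eq_measure flip: ennreal_plus)
      moreover have "prob (topspace X - B) = 1 - prob B"
        using prob_compl[OF B] sp by simp
      moreover have "prob (topspace X - V) = 1 - prob V"
        using prob_compl[OF opens[OF V(1)]] sp by simp
      ultimately have "prob B \<le> prob (topspace X - V) + e" by simp
      then have "emeasure borel_extension B \<le> emeasure borel_extension (topspace X - V) + e"
        using e by (simp add: emeasure_eq_measure flip: ennreal_plus)
      moreover have "compactin X (topspace X - V)"
        using V compact closedin_compact_space by blast
      then have "emeasure borel_extension (topspace X - V) \<le> ?S"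
        using V BX by (intro SUP_upper) auto
      ultimately show "emeasure borel_extension B \<le> ?S + e"
        by (meson add_right_mono order_trans)
    qed
  qed
qed

text \<open>\<open>inner\<close> and \<open>outer\<close> are built from clopen sets and
  \<open>f\<close>, so a bijection that permutes the clopen sets and preserves \<open>f\<close>
  preserves both. By \<open>h'\<close> every clopen set is an image, so the families under the
  supremum and the infimum correspond exactly.\<close>

lemma emeasure_borel_extension_image:
  assumes bij: "bij_betw h (topspace X) (topspace X)"
    and h: "\<And>A. A \<in> \<A> \<Longrightarrow> h ` A \<in> \<A>" and h': "\<And>A. A \<in> \<A> \<Longrightarrow> \<exists>A'\<in>\<A>. A = h ` A'"
    and fh: "\<And>A. A \<in> \<A> \<Longrightarrow> f (h ` A) = f A"
    and B: "B \<in> sets borel_extension"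
  shows "emeasure borel_extension (h ` B) = emeasure borel_extension B"
proof -
  have inj: "inj_on h (topspace X)" and im: "h ` topspace X = topspace X"
    using bij by (auto simp: bij_betw_def)
  have open_Union: "\<exists>\<U>\<subseteq>\<A>. U = \<Union>\<U>" if "openin X U" for U
    using base[OF that] by (intro exI[of _ "{A\<in>\<A>. A \<subseteq> U}"]) auto
  have hopen: "openin X (h ` U)" if U: "openin X U" for U
  proof -
    obtain \<U> where "\<U> \<subseteq> \<A>" "U = \<Union>\<U>" using open_Union[OF U] by auto
    then show ?thesis using h open_base by (auto simp: image_Union)
  qed
  have hopen': "\<exists>U'. openin X U' \<and> U = h ` U'" if U: "openin X U" for U
  proof -
    obtain \<U> where UU: "\<U> \<subseteq> \<A>" "U = \<Union>\<U>" using open_Union[OF U] by auto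
    obtain g where g: "\<And>A. A \<in> \<A> \<Longrightarrow> g A \<in> \<A> \<and> A = h ` g A" using h' by metis
    have "h ` (\<Union>A\<in>\<U>. g A) = (\<Union>A\<in>\<U>. h ` g A)" by (rule image_UN)
    also have "\<dots> = (\<Union>A\<in>\<U>. A)" using UU(1) g by (intro SUP_cong) auto
    finally have "U = h ` (\<Union>A\<in>\<U>. g A)" using UU(2) by simp
    moreover have "openin X (\<Union>A\<in>\<U>. g A)"
      using UU(1) g open_base by (intro openin_Union) blast
    ultimately show ?thesis by blast
  qed
  have sub: "h ` A \<subseteq> h ` C \<longleftrightarrow> A \<subseteq> C" if "A \<subseteq> topspace X" "C \<subseteq> topspace X" for A C
    using inj that by (simp add: inj_on_image_subset_iff)
  have inner_h: "inner (h ` U) = inner U" if U: "U \<subseteq> topspace X" for U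
  proof -
    have "{A\<in>\<A>. A \<subseteq> h ` U} = (`) h ` {A\<in>\<A>. A \<subseteq> U}"
      using h h' sub[OF sets_into_space U] by (auto simp: image_iff) metis
    then have "inner (h ` U) = (SUP A\<in>{A\<in>\<A>. A \<subseteq> U}. f (h ` A))"
      by (simp only: inner_def image_image)
    also have "\<dots> = inner U" unfolding inner_def by (rule SUP_cong) (auto simp: fh)
    finally show ?thesis .
  qed
  have outer_h: "outer (h ` C) = outer C" if C: "C \<subseteq> topspace X" for C
  proof -
    have "{U. openin X U \<and> h ` C \<subseteq> U} = (`) h ` {U. openin X U \<and> C \<subseteq> U}"
    proof (intro equalityI subsetI)
      fix U assume "U \<in> {U. openin X U \<and> h ` C \<subseteq> U}"
      then obtain U' where "openin X U'" "U = h ` U'" "h ` C \<subseteq> h ` U'"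
        using hopen'[of U] by auto
      then show "U \<in> (`) h ` {U. openin X U \<and> C \<subseteq> U}"
        using sub[OF C openin_subset] by auto
    qed (use hopen in auto)
    then have "outer (h ` C) = (INF U\<in>{U. openin X U \<and> C \<subseteq> U}. inner (h ` U))"
      by (simp only: outer_def image_image)
    also have "\<dots> = outer C" unfolding outer_def
      by (rule INF_cong) (auto intro: inner_h dest: openin_subset)
    finally show ?thesis .
  qed
  \<comment> \<open>The formula for \<open>emeasure\<close> in terms of \<open>outer\<close> is
    available on Borel sets, so images of Borel sets must be shown to be Borel.\<close>
  have hB: "h ` C \<in> sigma_sets (topspace X) {U. openin X U}"
    if "C \<in> sigma_sets (topspace X) {U. openin X U}" for C
    using that
  proof (induction rule: sigma_sets.induct)
    case (Basic U)
    then show ?case using hopen by auto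
  next
    case Empty
    then show ?case by (simp add: sigma_sets.Empty)
  next
    case (Compl C)
    have "C \<subseteq> topspace X"
      using sigma_sets_into_sp[OF _ Compl.hyps] by (auto dest: openin_subset)
    then have "h ` (topspace X - C) = topspace X - h ` C"
      using inj_on_image_set_diff[OF inj, of "topspace X" C] im by auto
    then show ?case using Compl.IH by (simp add: sigma_sets.Compl)
  next
    case (Union C)
    then show ?case by (simp add: image_UN sigma_sets.Union)
  qed
  have "B \<subseteq> topspace X" using sets.sets_into_space[OF B] space_borel_extension by simp
  then show ?thesis
    using B hB by (simp add: sets_borel_extension emeasure_borel_extension outer_h)
qed

end

section \<open>Substituting variables and parameters\<close>

text \<open>With the identity for \<open>h\<close> this is \<open>struct_over M\<close>; other
  \<open>h\<close> express on the semantic side what substituting or renaming parameters does to a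
  formula.\<close>

definition const_struct ::
    "('f, 'r, 'm) fo_struct \<Rightarrow> ('m \<Rightarrow> 'm) \<Rightarrow> ('f + 'm, 'r, 'm) fo_struct" where
  "const_struct M h = \<lparr>dom = dom M, fint = case_sum (fint M) (\<lambda>a _. h a), rint = rint M\<rparr>"

lemma const_struct_simps [simp]:
  "dom (const_struct M h) = dom M"
  "fint (const_struct M h) (Inl f) = fint M f"
  "fint (const_struct M h) (Inr a) xs = h a"
  "rint (const_struct M h) = rint M"
  by (simp_all add: const_struct_def)

lemma struct_over_simps [simp]:
  "dom (struct_over M) = dom M"
  "fint (struct_over M) (Inl f) = fint M f"
  "fint (struct_over M) (Inr a) xs = a"
  "rint (struct_over M) = rint M"
  by (simp_all add: struct_over_def)

lemma lang_over_simps [simp]: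
  "Inl f \<in> Funs (lang_over L A) \<longleftrightarrow> f \<in> Funs L"
  "Inr a \<in> Funs (lang_over L A) \<longleftrightarrow> a \<in> A"
  "Rels (lang_over L A) = Rels L"
  "farity (lang_over L A) (Inl f) = farity L f"
  "farity (lang_over L A) (Inr a) = 0"
  "rarity (lang_over L A) = rarity L"
  by (auto simp: lang_over_def)

lemma val_cong: "(\<And>i. i \<in> fv_tm t \<Longrightarrow> e i = e' i) \<Longrightarrow> val M e t = val M e' t"
proof (induction t)
  case (App f ts)
  then have "map (val M e) ts = map (val M e') ts" by auto
  then show ?case by (simp only: val.simps)
qed simp

lemma sat_cong: "(\<And>i. i \<in> fv \<phi> \<Longrightarrow> e i = e' i) \<Longrightarrow> sat M e \<phi> \<longleftrightarrow> sat M e' \<phi>"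
proof (induction \<phi> arbitrary: e e')
  case (Equal s t)
  then show ?case using val_cong[of s e e' M] val_cong[of t e e' M] by auto
next
  case (Rel r ts)
  then have "map (val M e) ts = map (val M e') ts" by (auto intro!: val_cong)
  then show ?case by (simp only: sat.simps)
next
  case (Neg \<phi>)
  from Neg.IH[of e e'] Neg.prems show ?case by simp
next
  case (Conj \<phi> \<psi>)
  from Conj.IH(1)[of e e'] Conj.IH(2)[of e e'] Conj.prems show ?case by simp
next
  case (Exists \<phi>)
  then have "sat M (case_nat a e) \<phi> \<longleftrightarrow> sat M (case_nat a e') \<phi>" for a
    by (intro Exists.IH) (auto split: nat.split)
  then show ?case by simp
qed

text \<open>\<open>subst_fm v c k\<close> replaces each free variable and each parameter by either a variable
  (\<open>Inl\<close>) or a parameter (\<open>Inr\<close>); \<open>k\<close> counts the quantifiers passed so far, so that indices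
  below \<open>k\<close> are bound.\<close>

fun atom_tm :: "nat \<Rightarrow> nat + 'm \<Rightarrow> ('f + 'm) tm" where
  "atom_tm k (Inl j) = Var (k + j)"
| "atom_tm k (Inr m) = App (Inr m) []"

fun subst_tm :: "(nat \<Rightarrow> nat + 'm) \<Rightarrow> ('m \<Rightarrow> nat + 'm) \<Rightarrow> nat \<Rightarrow> ('f + 'm) tm \<Rightarrow> ('f + 'm) tm" where
  "subst_tm v c k (Var i) = (if i < k then Var i else atom_tm k (v (i - k)))"
| "subst_tm v c k (App (Inl f) ts) = App (Inl f) (map (subst_tm v c k) ts)"
| "subst_tm v c k (App (Inr m) ts) = atom_tm k (c m)"

fun subst_fm :: "(nat \<Rightarrow> nat + 'm) \<Rightarrow> ('m \<Rightarrow> nat + 'm) \<Rightarrow> nat \<Rightarrow> ('f + 'm, 'r) fm \<Rightarrow> ('f + 'm, 'r) fm"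
where
  "subst_fm v c k (Equal s t) = Equal (subst_tm v c k s) (subst_tm v c k t)"
| "subst_fm v c k (Rel r ts) = Rel r (map (subst_tm v c k) ts)"
| "subst_fm v c k (Neg \<phi>) = Neg (subst_fm v c k \<phi>)"
| "subst_fm v c k (Conj \<phi> \<psi>) = Conj (subst_fm v c k \<phi>) (subst_fm v c k \<psi>)"
| "subst_fm v c k (Exists \<phi>) = Exists (subst_fm v c (Suc k) \<phi>)"

lemma val_atom_tm: "val (struct_over M) e (atom_tm k x) = case_sum (\<lambda>j. e (k + j)) id x"
  by (cases x) auto

lemma val_subst_tm:
  assumes "\<And>i. e' i = (if i < k then e i else case_sum (\<lambda>j. e (k + j)) id (v (i - k)))"
    and "\<And>a. h a = case_sum (\<lambda>j. e (k + j)) id (c a)"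
  shows "val (struct_over M) e (subst_tm v c k t) = val (const_struct M h) e' t"
proof (induction t)
  case (Var i)
  then show ?case using assms(1)[of i] by (simp add: val_atom_tm)
next
  case (App f ts)
  show ?case
  proof (cases f)
    case (Inl g)
    then show ?thesis using App by (simp cong: map_cong)
  next
    \<comment> \<open>The arguments that \<open>subst_tm\<close> drops here do not matter, because a
      parameter symbol ignores them in both structures.\<close>
    case (Inr m)
    then show ?thesis using assms(2) by (simp add: val_atom_tm)
  qed
qed

text \<open>Syntactic replacement equals reinterpretation: \<open>e'\<close> gives each variable,
  and \<open>h\<close> each parameter, the value of what replaces it. The induction varies
  \<open>k\<close>, since \<open>Exists\<close> raises it by one while shifting the assignment by
  one.\<close>

lemma sat_subst_fm:
  assumes "\<And>i. e' i = (if i < k then e i else case_sum (\<lambda>j. e (k + j)) id (v (i - k)))"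
    and "\<And>a. h a = case_sum (\<lambda>j. e (k + j)) id (c a)"
  shows "sat (struct_over M) e (subst_fm v c k \<phi>) \<longleftrightarrow> sat (const_struct M h) e' \<phi>"
  using assms
proof (induction \<phi> arbitrary: e e' k)
  case (Equal s t)
  note * = val_subst_tm[of e' k e v h c M, OF Equal.prems]
  show ?case by (simp add: *)
next
  case (Rel r ts)
  note * = val_subst_tm[of e' k e v h c M, OF Rel.prems]
  show ?case by (simp add: * comp_def)
next
  case (Neg \<phi>)
  note * = Neg.IH[of e' k e, OF Neg.prems]
  show ?case by (simp add: *)
next
  case (Conj \<phi> \<psi>)
  note * = Conj.IH(1)[of e' k e, OF Conj.prems] Conj.IH(2)[of e' k e, OF Conj.prems]
  show ?case by (simp add: *)
next
  case (Exists \<phi>)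
  have "sat (struct_over M) (case_nat a e) (subst_fm v c (Suc k) \<phi>) \<longleftrightarrow>
      sat (const_struct M h) (case_nat a e') \<phi>" for a
    using Exists.prems by (intro Exists.IH) (auto split: nat.split sum.split)
  then show ?case by simp
qed

lemma subst_tm_wf:
  assumes "wf_tm (lang_over L A) t" "\<And>i. i \<in> fv_tm t \<Longrightarrow> k \<le> i \<Longrightarrow> v (i - k) \<in> {..<n} <+> B"
    "\<And>a. a \<in> A \<Longrightarrow> c a \<in> {..<n} <+> B"
  shows "wf_tm (lang_over L B) (subst_tm v c k t) \<and> fv_tm (subst_tm v c k t) \<subseteq> {..<k + n}"
  using assms
proof (induction t)
  case (Var i)
  have "wf_tm (lang_over L B) (atom_tm k x) \<and> fv_tm (atom_tm k x) \<subseteq> {..<k + n}"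
    if "x \<in> {..<n} <+> B" for x
    using that by auto
  then show ?case using Var by auto
next
  case (App f ts)
  show ?case
  proof (cases f)
    case (Inl g)
    have "wf_tm (lang_over L B) (subst_tm v c k t) \<and> fv_tm (subst_tm v c k t) \<subseteq> {..<k + n}"
      if "t \<in> set ts" for t
      using that App.prems by (intro App.IH) auto
    then show ?thesis using Inl App.prems by fastforce
  next
    case (Inr m)
    then have "c m \<in> {..<n} <+> B" using App.prems by auto
    then show ?thesis using Inr by auto
  qed
qed

text \<open>The sum \<open>{..<n} <+> B\<close> lists the admissible replacements: variables below
  \<open>n\<close> and parameters from \<open>B\<close>. Under \<open>k\<close> quantifiers these
  variables appear shifted, whence the bound \<open>k + n\<close>.\<close>

lemma subst_fm_wf:
  assumes "wf_fm (lang_over L A) \<phi>" "\<And>i. i \<in> fv \<phi> \<Longrightarrow> k \<le> i \<Longrightarrow> v (i - k) \<in> {..<n} <+> B"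
    "\<And>a. a \<in> A \<Longrightarrow> c a \<in> {..<n} <+> B"
  shows "wf_fm (lang_over L B) (subst_fm v c k \<phi>) \<and> fv (subst_fm v c k \<phi>) \<subseteq> {..<k + n}"
  using assms
proof (induction \<phi> arbitrary: k)
  case (Equal s t)
  then show ?case using subst_tm_wf[of L A s k v n B c] subst_tm_wf[of L A t k v n B c] by auto
next
  case (Rel r ts)
  have "wf_tm (lang_over L B) (subst_tm v c k t) \<and> fv_tm (subst_tm v c k t) \<subseteq> {..<k + n}"
    if "t \<in> set ts" for t
    using that Rel.prems by (intro subst_tm_wf) auto
  then show ?case using Rel.prems by fastforce
next
  case (Exists \<phi>)
  have "wf_fm (lang_over L B) (subst_fm v c (Suc k) \<phi>) \<and>
      fv (subst_fm v c (Suc k) \<phi>) \<subseteq> {..<Suc k + n}"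
  proof (rule Exists.IH)
    fix i assume "i \<in> fv \<phi>" "Suc k \<le> i"
    \<comment> \<open>Index \<open>i\<close> free in \<open>\<phi>\<close> is index
      \<open>i - 1\<close> free in \<open>Exists \<phi>\<close>, and \<open>i - Suc k\<close> is
      \<open>(i - 1) - k\<close>.\<close>
    then show "v (i - Suc k) \<in> {..<n} <+> B"
      using Exists.prems(2)[of "i - 1"] by (cases i) auto
  qed (use Exists.prems in auto)
  then show ?case by auto
qed auto

section \<open>Renaming of parameters\<close>

definition param_tm :: "('m \<Rightarrow> 'm) \<Rightarrow> ('f + 'm) tm \<Rightarrow> ('f + 'm) tm" where
  "param_tm \<sigma> = map_tm (map_sum id \<sigma>)"

definition param_fm :: "('m \<Rightarrow> 'm) \<Rightarrow> ('f + 'm, 'r) fm \<Rightarrow> ('f + 'm, 'r) fm" where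
  "param_fm \<sigma> = map_fm (map_sum id \<sigma>) id"

lemma param_tm_simps [simp]:
  "param_tm \<sigma> (Var i) = Var i"
  "param_tm \<sigma> (App (Inl f) ts) = App (Inl f) (map (param_tm \<sigma>) ts)"
  "param_tm \<sigma> (App (Inr m) ts) = App (Inr (\<sigma> m)) (map (param_tm \<sigma>) ts)"
  by (simp_all add: param_tm_def)

lemma param_fm_simps [simp]:
  "param_fm \<sigma> (Equal s t) = Equal (param_tm \<sigma> s) (param_tm \<sigma> t)"
  "param_fm \<sigma> (Rel r ts) = Rel r (map (param_tm \<sigma>) ts)"
  "param_fm \<sigma> (Neg \<phi>) = Neg (param_fm \<sigma> \<phi>)"
  "param_fm \<sigma> (Conj \<phi> \<psi>) = Conj (param_fm \<sigma> \<phi>) (param_fm \<sigma> \<psi>)"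
  "param_fm \<sigma> (Exists \<phi>) = Exists (param_fm \<sigma> \<phi>)"
  by (simp_all add: param_tm_def param_fm_def)

lemma param_subst_tm:
  assumes "\<And>i. i \<in> fv_tm t \<Longrightarrow> k \<le> i \<Longrightarrow> v' (i - k) = case_sum Inl (\<lambda>m. Inr (\<sigma> m)) (v (i - k))"
    "\<And>a. c' a = case_sum Inl (\<lambda>m. Inr (\<sigma> m)) (c a)"
  shows "param_tm \<sigma> (subst_tm v c k t) = subst_tm v' c' k t"
  using assms
proof (induction t)
  case (Var i)
  then show ?case by (cases "v (i - k)") auto
next
  case (App f ts)
  show ?case
  proof (cases f)
    case (Inl g)
    have "param_tm \<sigma> (subst_tm v c k t) = subst_tm v' c' k t" if "t \<in> set ts" for t
      using that App.prems by (intro App.IH) auto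
    then show ?thesis using Inl by simp
  next
    case (Inr m)
    then show ?thesis using App.prems(2) by (cases "c m") auto
  qed
qed

text \<open>The condition on \<open>v'\<close> is limited to free variables because
  \<open>swap\<close> looks variables up in a list: past its end, lookup and \<open>map\<close> need
  not commute.\<close>

lemma param_subst_fm:
  assumes "\<And>i. i \<in> fv \<phi> \<Longrightarrow> k \<le> i \<Longrightarrow> v' (i - k) = case_sum Inl (\<lambda>m. Inr (\<sigma> m)) (v (i - k))"
    "\<And>a. c' a = case_sum Inl (\<lambda>m. Inr (\<sigma> m)) (c a)"
  shows "param_fm \<sigma> (subst_fm v c k \<phi>) = subst_fm v' c' k \<phi>"
  using assms
proof (induction \<phi> arbitrary: k)
  case (Equal s t)
  have "param_tm \<sigma> (subst_tm v c k s) = subst_tm v' c' k s"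
    "param_tm \<sigma> (subst_tm v c k t) = subst_tm v' c' k t"
    using Equal.prems by (auto intro!: param_subst_tm)
  then show ?case by simp
next
  case (Rel r ts)
  have "param_tm \<sigma> (subst_tm v c k t) = subst_tm v' c' k t" if "t \<in> set ts" for t
    using that Rel.prems by (intro param_subst_tm) auto
  then show ?case by simp
next
  case (Exists \<phi>)
  have "param_fm \<sigma> (subst_fm v c (Suc k) \<phi>) = subst_fm v' c' (Suc k) \<phi>"
  proof (rule Exists.IH)
    fix i assume "i \<in> fv \<phi>" "Suc k \<le> i"
    then show "v' (i - Suc k) = case_sum Inl (\<lambda>m. Inr (\<sigma> m)) (v (i - Suc k))"
      using Exists.prems(1)[of "i - 1"] by (cases i) auto
  qed (use Exists.prems in auto)
  then show ?case by simp
qed auto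

section \<open>Formulas use finitely many parameters\<close>

lemma wf_tm_mono: "wf_tm (lang_over L A) t \<Longrightarrow> A \<subseteq> B \<Longrightarrow> wf_tm (lang_over L B) t"
proof (induction t)
  case (App f ts)
  then show ?case by (cases f) auto
qed simp

lemma wf_fm_mono: "wf_fm (lang_over L A) \<phi> \<Longrightarrow> A \<subseteq> B \<Longrightarrow> wf_fm (lang_over L B) \<phi>"
  by (induction \<phi>) (auto intro: wf_tm_mono)

lemma formulas_mono: "A \<subseteq> B \<Longrightarrow> formulas (lang_over L A) n \<subseteq> formulas (lang_over L B) n"
  by (auto simp: formulas_def intro: wf_fm_mono)

lemma wf_tm_finite_params:
  "wf_tm (lang_over L A) t \<Longrightarrow> \<exists>B. finite B \<and> B \<subseteq> A \<and> wf_tm (lang_over L B) t"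
proof (induction t)
  case (App f ts)
  have "\<exists>B. finite B \<and> B \<subseteq> A \<and> wf_tm (lang_over L B) t" if "t \<in> set ts" for t
    using App that by (cases f) auto
  then obtain B where B: "\<And>t. t \<in> set ts \<Longrightarrow> finite (B t)" "\<And>t. t \<in> set ts \<Longrightarrow> B t \<subseteq> A"
    "\<And>t. t \<in> set ts \<Longrightarrow> wf_tm (lang_over L (B t)) t"
    by metis
  show ?case
  proof (cases f)
    case (Inl g)
    have "wf_tm (lang_over L (\<Union>t\<in>set ts. B t)) t" if "t \<in> set ts" for t
      using that by (intro wf_tm_mono[OF B(3)]) auto
    moreover have "finite (\<Union>t\<in>set ts. B t)" "(\<Union>t\<in>set ts. B t) \<subseteq> A" using B(1,2) by auto
    ultimately show ?thesis using App.prems Inl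
      by (intro exI[of _ "\<Union>t\<in>set ts. B t"]) simp
  next
    case (Inr m)
    then show ?thesis using App.prems by (intro exI[of _ "{m}"]) auto
  qed
qed auto

lemma wf_fm_finite_params:
  "wf_fm (lang_over L A) \<phi> \<Longrightarrow> \<exists>B. finite B \<and> B \<subseteq> A \<and> wf_fm (lang_over L B) \<phi>"
proof (induction \<phi>)
  case (Equal s t)
  then obtain B C where "finite B" "B \<subseteq> A" "wf_tm (lang_over L B) s"
    "finite C" "C \<subseteq> A" "wf_tm (lang_over L C) t"
    using wf_tm_finite_params by (metis wf_fm.simps(1))
  then show ?case using wf_tm_mono[of L B s "B \<union> C"] wf_tm_mono[of L C t "B \<union> C"]
    by (intro exI[of _ "B \<union> C"]) auto
next
  case (Rel r ts)
  then have "\<exists>B. finite B \<and> B \<subseteq> A \<and> wf_tm (lang_over L B) t" if "t \<in> set ts" for t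
    using that wf_tm_finite_params[of L A] by auto
  then obtain B where B: "\<And>t. t \<in> set ts \<Longrightarrow> finite (B t)" "\<And>t. t \<in> set ts \<Longrightarrow> B t \<subseteq> A"
    "\<And>t. t \<in> set ts \<Longrightarrow> wf_tm (lang_over L (B t)) t"
    by metis
  have "wf_tm (lang_over L (\<Union>t\<in>set ts. B t)) t" if "t \<in> set ts" for t
    using that by (intro wf_tm_mono[OF B(3)]) auto
  moreover have "finite (\<Union>t\<in>set ts. B t)" "(\<Union>t\<in>set ts. B t) \<subseteq> A" using B(1,2) by auto
  ultimately show ?case using Rel.prems by (intro exI[of _ "\<Union>t\<in>set ts. B t"]) simp
next
  case (Conj \<phi> \<psi>)
  then obtain B C where "finite B" "B \<subseteq> A" "wf_fm (lang_over L B) \<phi>"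
    "finite C" "C \<subseteq> A" "wf_fm (lang_over L C) \<psi>" by auto
  then show ?case using wf_fm_mono[of L B \<phi> "B \<union> C"] wf_fm_mono[of L C \<psi> "B \<union> C"]
    by (intro exI[of _ "B \<union> C"]) auto
qed auto

text \<open>Collects the parameters of finitely many formulas in one tuple, so that all formulas of
  a coloring take the form \<phi>(x; d) with the same d.\<close>

lemma formulas_finite_params:
  assumes "finite I" "\<And>i. i \<in> I \<Longrightarrow> \<phi> i \<in> formulas (lang_over L A) n"
  shows "\<exists>d. set d \<subseteq> A \<and> (\<forall>i\<in>I. \<phi> i \<in> formulas (lang_over L (set d)) n)"
proof -
  have "\<exists>B. finite B \<and> B \<subseteq> A \<and> wf_fm (lang_over L B) (\<phi> i)" if "i \<in> I" for i
    using assms(2)[OF that] wf_fm_finite_params[of L A] by (auto simp: formulas_def)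
  then obtain B where B: "\<And>i. i \<in> I \<Longrightarrow> finite (B i) \<and> B i \<subseteq> A \<and> wf_fm (lang_over L (B i)) (\<phi> i)"
    by metis
  have "finite (\<Union>i\<in>I. B i)" using B assms(1) by auto
  then obtain d where d: "set d = (\<Union>i\<in>I. B i)" using finite_list by metis
  have "\<phi> i \<in> formulas (lang_over L (set d)) n" if "i \<in> I" for i
    using assms(2)[OF that] B[OF that] wf_fm_mono[of L "B i" "\<phi> i" "set d"] that d
    by (auto simp: formulas_def)
  then show ?thesis using d B by (intro exI[of _ d]) auto
qed

section \<open>Functoriality and semantics of renaming\<close>

lemma param_tm_cong:
  "wf_tm (lang_over L A) t \<Longrightarrow> (\<And>a. a \<in> A \<Longrightarrow> \<sigma> a = \<tau> a) \<Longrightarrow> param_tm \<sigma> t = param_tm \<tau> t"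
proof (induction t)
  case (App f ts)
  then show ?case by (cases f) auto
qed simp

lemma param_fm_cong:
  "wf_fm (lang_over L A) \<phi> \<Longrightarrow> (\<And>a. a \<in> A \<Longrightarrow> \<sigma> a = \<tau> a) \<Longrightarrow> param_fm \<sigma> \<phi> = param_fm \<tau> \<phi>"
  by (induction \<phi>) (auto intro: param_tm_cong)

lemma param_fm_ident:
  assumes "wf_fm (lang_over L A) \<phi>" "\<And>a. a \<in> A \<Longrightarrow> \<sigma> a = a"
  shows "param_fm \<sigma> \<phi> = \<phi>"
  using param_fm_cong[of L A \<phi> \<sigma> id] assms by (simp add: param_fm_def sum.map_id0 fm.map_id0)

lemma param_fm_comp: "param_fm \<tau> (param_fm \<sigma> \<phi>) = param_fm (\<tau> \<circ> \<sigma>) \<phi>"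
  by (simp add: param_fm_def fm.map_comp map_sum.comp)

lemma wf_param_tm: "wf_tm (lang_over L A) t \<Longrightarrow> wf_tm (lang_over L (\<sigma> ` A)) (param_tm \<sigma> t)"
proof (induction t)
  case (App f ts)
  then show ?case by (cases f) auto
qed simp

lemma fv_map_tm: "fv_tm (map_tm g t) = fv_tm t"
  by (induction t) auto

lemma fv_map_fm: "fv (map_fm g g' \<phi>) = fv \<phi>"
  by (induction \<phi>) (auto simp: fv_map_tm)

lemma wf_param_fm: "wf_fm (lang_over L A) \<phi> \<Longrightarrow> wf_fm (lang_over L (\<sigma> ` A)) (param_fm \<sigma> \<phi>)"
  by (induction \<phi>) (auto simp: wf_param_tm)

lemma param_formulas:
  "\<phi> \<in> formulas (lang_over L A) n \<Longrightarrow> param_fm \<sigma> \<phi> \<in> formulas (lang_over L (\<sigma> ` A)) n"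
  by (auto simp: formulas_def wf_param_fm) (auto simp: param_fm_def fv_map_fm)

lemma val_param_tm: "val (struct_over M) e (param_tm \<sigma> t) = val (const_struct M \<sigma>) e t"
proof (induction t)
  case (App f ts)
  then show ?case by (cases f) (simp_all cong: map_cong)
qed simp

lemma sat_param_fm: "sat (struct_over M) e (param_fm \<sigma> \<phi>) \<longleftrightarrow> sat (const_struct M \<sigma>) e \<phi>"
  by (induction \<phi> arbitrary: e) (auto simp: val_param_tm comp_def cong: map_cong)

section \<open>Formulas of \<open>L\<close> as formulas with parameters\<close>

lemma val_map_Inl: "val (const_struct M h) e (map_tm Inl t) = val M e t"
proof (induction t)
  case (App f ts)
  then show ?case by (simp cong: map_cong)
qed simp

lemma sat_map_Inl: "sat (const_struct M h) e (map_fm Inl id \<phi>) \<longleftrightarrow> sat M e \<phi>"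
  by (induction \<phi> arbitrary: e) (auto simp: val_map_Inl comp_def cong: map_cong)

lemma wf_map_Inl_tm: "wf_tm L t \<Longrightarrow> wf_tm (lang_over L A) (map_tm Inl t)"
  by (induction t) auto

lemma wf_map_Inl: "wf_fm L \<phi> \<Longrightarrow> wf_fm (lang_over L A) (map_fm Inl id \<phi>)"
  by (induction \<phi>) (auto simp: wf_map_Inl_tm)

section \<open>Automorphisms\<close>

lemma is_struct_fint:
  "is_struct L M \<Longrightarrow> f \<in> Funs L \<Longrightarrow> set xs \<subseteq> dom M \<Longrightarrow> length xs = farity L f \<Longrightarrow> fint M f xs \<in> dom M"
  by (simp add: is_struct_def)

lemma Aut_fint:
  "\<sigma> \<in> Aut L M \<Longrightarrow> f \<in> Funs L \<Longrightarrow> set xs \<subseteq> dom M \<Longrightarrow> length xs = farity L f \<Longrightarrow>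
    \<sigma> (fint M f xs) = fint M f (map \<sigma> xs)"
  unfolding Aut_def by blast

lemma Aut_rint:
  "\<sigma> \<in> Aut L M \<Longrightarrow> r \<in> Rels L \<Longrightarrow> set xs \<subseteq> dom M \<Longrightarrow> length xs = rarity L r \<Longrightarrow>
    rint M r xs = rint M r (map \<sigma> xs)"
  unfolding Aut_def by blast

section \<open>Automorphisms preserve truth\<close>

lemma val_in_dom:
  assumes M: "is_struct L M" and A: "A \<subseteq> dom M"
  shows "wf_tm (lang_over L A) t \<Longrightarrow> (\<And>i. i \<in> fv_tm t \<Longrightarrow> e i \<in> dom M) \<Longrightarrow>
    val (struct_over M) e t \<in> dom M"
proof (induction t)
  case (App f ts)
  show ?case
  proof (cases f)
    case (Inl g)
    have "val (struct_over M) e t \<in> dom M" if "t \<in> set ts" for t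
      using that App.prems Inl by (intro App.IH) auto
    then show ?thesis using App.prems Inl by (auto intro!: is_struct_fint[OF M])
  next
    case (Inr m)
    then show ?thesis using App.prems A by auto
  qed
qed simp

lemma val_Aut:
  assumes M: "is_struct L M" and A: "A \<subseteq> dom M" and \<sigma>: "\<sigma> \<in> Aut L M"
    and h: "\<And>a. a \<in> A \<Longrightarrow> h a = \<sigma> a"
  shows "wf_tm (lang_over L A) t \<Longrightarrow> (\<And>i. i \<in> fv_tm t \<Longrightarrow> e i \<in> dom M \<and> e' i = \<sigma> (e i)) \<Longrightarrow>
    val (const_struct M h) e' t = \<sigma> (val (struct_over M) e t)"
proof (induction t)
  case (App f ts)
  show ?case
  proof (cases f)
    case (Inl g)
    have IH: "val (const_struct M h) e' t = \<sigma> (val (struct_over M) e t)"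
      and d: "val (struct_over M) e t \<in> dom M" if "t \<in> set ts" for t
    proof -
      show "val (const_struct M h) e' t = \<sigma> (val (struct_over M) e t)"
        using that App.prems Inl by (intro App.IH) auto
      show "val (struct_over M) e t \<in> dom M"
        using that App.prems Inl by (intro val_in_dom[OF M A]) auto
    qed
    have "\<sigma> (fint M g (map (val (struct_over M) e) ts)) =
        fint M g (map \<sigma> (map (val (struct_over M) e) ts))"
      using d App.prems Inl by (intro Aut_fint[OF \<sigma>]) auto
    then show ?thesis using Inl IH by (simp add: comp_def cong: map_cong)
  next
    case (Inr m)
    then show ?thesis using App.prems h by auto
  qed
qed simp

text \<open>Injectivity of \<open>\<sigma>\<close> handles equations and surjectivity the
  quantifier. Agreement of \<open>h\<close> with \<open>\<sigma>\<close> is asked on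
  \<open>A\<close> alone so that two cases are covered: renaming, where \<open>h\<close> is
  \<open>\<sigma>\<close>, and \<open>swap\<close>, where \<open>h\<close> is a lookup in
  \<open>map \<sigma> d\<close>.\<close>

lemma sat_Aut:
  assumes M: "is_struct L M" and A: "A \<subseteq> dom M" and \<sigma>: "\<sigma> \<in> Aut L M"
    and h: "\<And>a. a \<in> A \<Longrightarrow> h a = \<sigma> a"
  shows "wf_fm (lang_over L A) \<phi> \<Longrightarrow> (\<And>i. i \<in> fv \<phi> \<Longrightarrow> e i \<in> dom M \<and> e' i = \<sigma> (e i)) \<Longrightarrow>
    sat (const_struct M h) e' \<phi> \<longleftrightarrow> sat (struct_over M) e \<phi>"
proof (induction \<phi> arbitrary: e e')
  case (Equal s t)
  have "val (const_struct M h) e' s = \<sigma> (val (struct_over M) e s)"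
    "val (const_struct M h) e' t = \<sigma> (val (struct_over M) e t)"
    using Equal.prems by (auto intro!: val_Aut[OF M A \<sigma> h])
  moreover have "val (struct_over M) e s \<in> dom M" "val (struct_over M) e t \<in> dom M"
    using Equal.prems by (auto intro!: val_in_dom[OF M A])
  moreover have "inj_on \<sigma> (dom M)" using \<sigma> by (auto simp: Aut_def bij_betw_def)
  ultimately show ?case by (simp add: inj_on_eq_iff)
next
  case (Rel r ts)
  have v: "val (const_struct M h) e' t = \<sigma> (val (struct_over M) e t)" if "t \<in> set ts" for t
    using Rel.prems that by (intro val_Aut[OF M A \<sigma> h]) auto
  have "val (struct_over M) e t \<in> dom M" if "t \<in> set ts" for t
    using Rel.prems that by (intro val_in_dom[OF M A]) auto
  then have "rint M r (map (val (struct_over M) e) ts) =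
      rint M r (map \<sigma> (map (val (struct_over M) e) ts))"
    using Rel.prems by (intro Aut_rint[OF \<sigma>]) auto
  then show ?case using v by (simp add: comp_def cong: map_cong)
next
  case (Neg \<phi>)
  from Neg.IH[of e e'] Neg.prems show ?case by simp
next
  case (Conj \<phi> \<psi>)
  from Conj.IH(1)[of e e'] Conj.IH(2)[of e e'] Conj.prems show ?case by simp
next
  case (Exists \<phi>)
  have IH: "sat (const_struct M h) (case_nat (\<sigma> a) e') \<phi> \<longleftrightarrow> sat (struct_over M) (case_nat a e) \<phi>"
    if "a \<in> dom M" for a
    using that Exists.prems by (intro Exists.IH) (auto split: nat.split)
  have "\<sigma> ` dom M = dom M" using \<sigma> by (auto simp: Aut_def bij_betw_def)
  then have "(\<exists>b\<in>dom M. sat (const_struct M h) (case_nat b e') \<phi>) \<longleftrightarrow>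
      (\<exists>a\<in>dom M. sat (const_struct M h) (case_nat (\<sigma> a) e') \<phi>)" by (metis imageE imageI)
  then show ?case using IH by simp
qed

lemma holds_Aut_const:
  assumes "is_struct L M" "A \<subseteq> dom M" "\<sigma> \<in> Aut L M" "\<And>a. a \<in> A \<Longrightarrow> h a = \<sigma> a"
    and "\<phi> \<in> formulas (lang_over L A) (length xs)" "set xs \<subseteq> dom M"
  shows "holds (const_struct M h) \<phi> (map \<sigma> xs) \<longleftrightarrow> holds (struct_over M) \<phi> xs"
  unfolding holds_def
  using assms by (intro sat_Aut[OF assms(1-4)]) (auto simp: formulas_def subset_iff)

lemma holds_param_fm:
  assumes "is_struct L M" "A \<subseteq> dom M" "\<sigma> \<in> Aut L M"
    and "\<phi> \<in> formulas (lang_over L A) (length xs)" "set xs \<subseteq> dom M"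
  shows "holds (struct_over M) (param_fm \<sigma> \<phi>) (map \<sigma> xs) \<longleftrightarrow> holds (struct_over M) \<phi> xs"
  using holds_Aut_const[of L M A \<sigma> \<sigma> \<phi> xs] assms by (simp add: holds_def sat_param_fm)

text \<open>A formula without parameters is fixed by renaming, so its truth transfers along
  \<open>\<sigma>\<close>.\<close>

lemma tp_Aut:
  assumes "is_struct L M" "\<sigma> \<in> Aut L M" "set xs \<subseteq> dom M"
  shows "tp L M {} (map \<sigma> xs) = tp L M {} xs"
proof -
  have "holds (struct_over M) \<phi> (map \<sigma> xs) \<longleftrightarrow> holds (struct_over M) \<phi> xs"
    if \<phi>: "\<phi> \<in> formulas (lang_over L {}) (length xs)" for \<phi>
  proof -
    have "param_fm \<sigma> \<phi> = \<phi>" using \<phi> by (intro param_fm_ident[of L "{}"]) (auto simp: formulas_def)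
    then show ?thesis using holds_param_fm[of L M "{}" \<sigma> \<phi> xs] assms \<phi> by simp
  qed
  then show ?thesis by (auto simp: tp_def)
qed

section \<open>Inverses and composites of automorphisms\<close>

lemma Aut_inv:
  assumes M: "is_struct L M" and \<sigma>: "\<sigma> \<in> Aut L M"
  shows "inv_into (dom M) \<sigma> \<in> Aut L M"
proof -
  let ?\<tau> = "inv_into (dom M) \<sigma>"
  have b: "bij_betw \<sigma> (dom M) (dom M)" using \<sigma> by (simp add: Aut_def)
  have b': "bij_betw ?\<tau> (dom M) (dom M)" by (rule bij_betw_inv_into[OF b])
  have l: "?\<tau> (\<sigma> x) = x" and r: "\<sigma> (?\<tau> x) = x" and d: "?\<tau> x \<in> dom M" if "x \<in> dom M" for x
    using that bij_betw_inv_into_left[OF b] bij_betw_inv_into_right[OF b] b'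
    by (auto simp: bij_betw_def)
  have rl: "map \<sigma> (map ?\<tau> xs) = xs" if "set xs \<subseteq> dom M" for xs
    using that r by (auto intro!: map_idI simp: comp_def)
  show ?thesis unfolding Aut_def
  proof (intro CollectI conjI ballI allI impI)
    fix f xs assume f: "f \<in> Funs L" and xs: "set xs \<subseteq> dom M \<and> length xs = farity L f"
    then have xs': "set (map ?\<tau> xs) \<subseteq> dom M \<and> length (map ?\<tau> xs) = farity L f" using d by auto
    then have "\<sigma> (fint M f (map ?\<tau> xs)) = fint M f (map \<sigma> (map ?\<tau> xs))"
      using \<sigma> f unfolding Aut_def by blast
    then have "\<sigma> (fint M f (map ?\<tau> xs)) = fint M f xs" using rl xs by simp
    moreover have "fint M f (map ?\<tau> xs) \<in> dom M" using M f xs' unfolding is_struct_def by blast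
    ultimately show "?\<tau> (fint M f xs) = fint M f (map ?\<tau> xs)" using l by metis
  next
    fix R xs assume R: "R \<in> Rels L" and xs: "set xs \<subseteq> dom M \<and> length xs = rarity L R"
    then have xs': "set (map ?\<tau> xs) \<subseteq> dom M \<and> length (map ?\<tau> xs) = rarity L R" using d by auto
    then have "rint M R (map ?\<tau> xs) = rint M R (map \<sigma> (map ?\<tau> xs))"
      using \<sigma> R unfolding Aut_def by blast
    then show "rint M R xs = rint M R (map ?\<tau> xs)" using rl xs by simp
  qed (rule b')
qed

lemma Aut_comp:
  assumes M: "is_struct L M" and \<sigma>: "\<sigma> \<in> Aut L M" and \<tau>: "\<tau> \<in> Aut L M"
  shows "\<tau> \<circ> \<sigma> \<in> Aut L M"
  unfolding Aut_def
proof (intro CollectI conjI ballI allI impI)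
  have sd: "set (map \<sigma> xs) \<subseteq> dom M" if "set xs \<subseteq> dom M" for xs
    using that \<sigma> by (auto simp: Aut_def bij_betw_def)
  show "bij_betw (\<tau> \<circ> \<sigma>) (dom M) (dom M)"
    using \<sigma> \<tau> by (auto simp: Aut_def intro: bij_betw_trans)
  show "(\<tau> \<circ> \<sigma>) (fint M f xs) = fint M f (map (\<tau> \<circ> \<sigma>) xs)"
    if f: "f \<in> Funs L" and xs: "set xs \<subseteq> dom M \<and> length xs = farity L f" for f xs
  proof -
    have "\<sigma> (fint M f xs) = fint M f (map \<sigma> xs)" using \<sigma> f xs unfolding Aut_def by blast
    moreover have "\<tau> (fint M f (map \<sigma> xs)) = fint M f (map \<tau> (map \<sigma> xs))"
      using \<tau> f xs sd unfolding Aut_def by simp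
    ultimately show ?thesis by simp
  qed
  show "rint M R xs = rint M R (map (\<tau> \<circ> \<sigma>) xs)"
    if R: "R \<in> Rels L" and xs: "set xs \<subseteq> dom M \<and> length xs = rarity L R" for R xs
  proof -
    have "rint M R xs = rint M R (map \<sigma> xs)" using \<sigma> R xs unfolding Aut_def by blast
    moreover have "rint M R (map \<sigma> xs) = rint M R (map \<tau> (map \<sigma> xs))"
      using \<tau> R xs sd[of xs] unfolding Aut_def by simp
    ultimately show ?thesis by simp
  qed
qed

lemma map_inv_Aut:
  assumes "\<sigma> \<in> Aut L M" "set xs \<subseteq> dom M"
  shows "map \<sigma> (map (inv_into (dom M) \<sigma>) xs) = xs" "map (inv_into (dom M) \<sigma>) (map \<sigma> xs) = xs"
proof -
  have b: "bij_betw \<sigma> (dom M) (dom M)" using assms by (simp add: Aut_def)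
  show "map \<sigma> (map (inv_into (dom M) \<sigma>) xs) = xs" "map (inv_into (dom M) \<sigma>) (map \<sigma> xs) = xs"
    using assms(2) bij_betw_inv_into_left[OF b] bij_betw_inv_into_right[OF b]
    by (auto intro!: map_idI simp: comp_def)
qed

lemma Aut_in_dom: "\<sigma> \<in> Aut L M \<Longrightarrow> x \<in> dom M \<Longrightarrow> \<sigma> x \<in> dom M"
  by (auto simp: Aut_def bij_betw_def)

section \<open>Exchange of variables and parameters\<close>

definition index_of :: "'a list \<Rightarrow> 'a \<Rightarrow> nat" where
  "index_of xs x = (LEAST i. xs ! i = x)"

text \<open>Taking the least index fixes one position even in a tuple with repetitions; it is at
  most any actual position and hence inside the list.\<close>

lemma index_of:
  assumes "x \<in> set xs"
  shows "index_of xs x < length xs" "xs ! index_of xs x = x"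
proof -
  obtain i where i: "i < length xs" "xs ! i = x" using assms by (auto simp: in_set_conv_nth)
  show "xs ! index_of xs x = x" unfolding index_of_def by (rule LeastI) (rule i(2))
  show "index_of xs x < length xs"
    using Least_le[of "\<lambda>i. xs ! i = x", OF i(2)] i(1) unfolding index_of_def by simp
qed

text \<open>\<open>swap a d \<phi>\<close> turns \<open>\<phi>(x; d)\<close> into \<open>\<phi>(a; z)\<close>, exchanging the roles of variables and
  parameters.\<close>

definition swap :: "'m list \<Rightarrow> 'm list \<Rightarrow> ('f + 'm, 'r) fm \<Rightarrow> ('f + 'm, 'r) fm" where
  "swap a d = subst_fm (\<lambda>i. Inr (a ! i)) (\<lambda>m. Inl (index_of d m)) 0"

lemma swap_formulas:
  assumes "\<phi> \<in> formulas (lang_over L (set d)) (length a)"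
  shows "swap a d \<phi> \<in> formulas (lang_over L (set a)) (length d)"
proof -
  have "wf_fm (lang_over L (set a)) (swap a d \<phi>) \<and> fv (swap a d \<phi>) \<subseteq> {..<0 + length d}"
    unfolding swap_def using assms
    by (intro subst_fm_wf[of L "set d"]) (auto simp: formulas_def intro: index_of)
  then show ?thesis by (simp add: formulas_def)
qed

text \<open>By the substitution lemma the left side says \<phi>(\<sigma> a; \<sigma> d), which is
  equivalent to \<phi>(a; d) because automorphisms preserve truth.\<close>

lemma holds_swap:
  assumes "is_struct L M" "\<sigma> \<in> Aut L M" "set d \<subseteq> dom M" "set a \<subseteq> dom M"
    and "\<phi> \<in> formulas (lang_over L (set d)) (length a)"
  shows "holds (struct_over M) (swap (map \<sigma> a) d \<phi>) (map \<sigma> d) \<longleftrightarrow> holds (struct_over M) \<phi> a"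
proof -
  have "holds (struct_over M) (swap (map \<sigma> a) d \<phi>) (map \<sigma> d) \<longleftrightarrow>
      holds (const_struct M (\<lambda>m. map \<sigma> d ! index_of d m)) \<phi> (map \<sigma> a)"
    unfolding holds_def swap_def by (rule sat_subst_fm) auto
  also have "\<dots> \<longleftrightarrow> holds (struct_over M) \<phi> a"
    using assms by (intro holds_Aut_const[of L M "set d"]) (auto simp: index_of)
  finally show ?thesis .
qed

text \<open>After the swap every parameter of \<open>\<phi>\<close> has become a variable, so
  renaming moves nothing but the entries of \<open>a\<close>.\<close>

lemma param_swap:
  assumes "\<phi> \<in> formulas L' (length a)"
  shows "param_fm \<sigma> (swap a d \<phi>) = swap (map \<sigma> a) d \<phi>"
  unfolding swap_def using assms by (intro param_subst_fm) (auto simp: formulas_def)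

section \<open>Small sets and homogeneity in the monster model\<close>

lemma monster_finite:
  fixes L :: "('f, 'r) language"
  assumes mon: "monster_model L T \<kappa> M" and "finite A"
  shows "|A| <o \<kappa>"
proof -
  \<comment> \<open>The trivial equations in single variables already make the set of formulas
    infinite; a finite set is smaller, hence smaller than \<kappa>.\<close>
  have "inj (\<lambda>i. Equal (Var i) (Var i) :: ('f, 'r) fm)" by (auto simp: inj_def)
  then have "infinite (range (\<lambda>i. Equal (Var i) (Var i) :: ('f, 'r) fm))"
    using range_inj_infinite by blast
  moreover have "range (\<lambda>i. Equal (Var i) (Var i) :: ('f, 'r) fm) \<subseteq> {\<phi>. wf_fm L \<phi>}" by auto
  ultimately have "infinite {\<phi>. wf_fm L \<phi>}" using finite_subset by blast
  then have "|A| <o |{\<phi>. wf_fm L \<phi>}|" 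
   
      using assms(2) card_of_ordLeq_finite not_ordLeq_iff_ordLess[OF card_of_Well_order card_of_Well_order]
    by blast
  then show ?thesis using mon ordLess_transitive unfolding monster_model_def by blast
qed

lemma monster_homogeneous:
  fixes L :: "('f, 'r) language" and M :: "('f, 'r, 'm) fo_struct"
  assumes mon: "monster_model L T \<kappa> M" and a: "set a \<subseteq> dom M" and a': "set a' \<subseteq> dom M"
    and len: "length a' = length a" and tp: "tp L M {} a' = tp L M {} a"
  shows "\<exists>\<sigma>\<in>Aut L M. map \<sigma> a = a'"
proof -
  define f where "f x = a' ! index_of a x" for x
  have iff: "holds (struct_over M) \<phi> a \<longleftrightarrow> holds (struct_over M) \<phi> a'"
    if "\<phi> \<in> formulas (lang_over L {}) (length a)" for \<phi>
  proof -
    have "\<phi> \<in> tp L M {} a' \<longleftrightarrow> \<phi> \<in> tp L M {} a" using tp by simp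
    then show ?thesis using that len by (simp add: tp_def)
  qed
  \<comment> \<open>The type decides which entries coincide, so \<open>f\<close> sends every
    \<open>a ! i\<close> to \<open>a' ! i\<close> also when \<open>a\<close> has
    repetitions.\<close>
  have eq: "a' ! i = a' ! j" if "i < length a" "j < length a" "a ! i = a ! j" for i j
    using iff[of "Equal (Var i) (Var j)"] that by (auto simp: formulas_def holds_def)
  have fa: "f (a ! i) = a' ! i" if "i < length a" for i
    unfolding f_def using that by (intro eq index_of) auto
  have mf: "map f a = a'" using len fa by (auto intro: nth_equalityI)
  have "partial_elementary L M (set a) f" unfolding partial_elementary_def
  proof (intro conjI allI impI ballI)
    show "set a \<subseteq> dom M" by fact
    show "f ` set a \<subseteq> dom M" using a' mf by (metis set_map)
    fix xs \<phi> assume xs: "set xs \<subseteq> set a" and \<phi>: "\<phi> \<in> formulas L (length xs)"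
    \<comment> \<open>Rewrites \<phi>(xs) as a formula about the whole tuple \<open>a\<close>:
      variable \<open>i\<close> becomes the position of \<open>xs ! i\<close> in \<open>a\<close>.
      The value \<open>Inl 0\<close> for parameters is a dummy, as none occur in
      \<open>map_fm Inl id \<phi>\<close>.\<close>
    define \<psi> :: "('f + 'm, 'r) fm"
      where "\<psi> = subst_fm (\<lambda>i. Inl (index_of a (xs ! i))) (\<lambda>m. Inl 0) 0 (map_fm Inl id \<phi>)"
    have sat: "holds (struct_over M) \<psi> b \<longleftrightarrow> sat M (\<lambda>i. b ! index_of a (xs ! i)) \<phi>" for b
    proof -
      have "holds (struct_over M) \<psi> b \<longleftrightarrow>
          sat (const_struct M (\<lambda>m. b ! 0)) (\<lambda>i. b ! index_of a (xs ! i)) (map_fm Inl id \<phi>)"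
        unfolding holds_def \<psi>_def by (rule sat_subst_fm) auto
      then show ?thesis by (simp add: sat_map_Inl)
    qed
    have idx: "index_of a (xs ! i) < length a" "a ! index_of a (xs ! i) = xs ! i"
      if "i < length xs" for i
      using that xs by (auto intro!: index_of)
    have wf: "wf_fm (lang_over L {}) (map_fm Inl id \<phi>)"
      using \<phi> by (auto simp: formulas_def wf_map_Inl)
    have "\<psi> \<in> formulas (lang_over L {}) (length a)"
    proof -
      have "wf_fm (lang_over L {}) \<psi> \<and> fv \<psi> \<subseteq> {..<0 + length a}"
        unfolding \<psi>_def using \<phi> idx(1)
        by (intro subst_fm_wf[OF wf]) (auto simp: formulas_def fv_map_fm)
      then show ?thesis by (simp add: formulas_def)
    qed
    then have "sat M (\<lambda>i. a ! index_of a (xs ! i)) \<phi> \<longleftrightarrow> sat M (\<lambda>i. a' ! index_of a (xs ! i)) \<phi>"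
      using iff sat by blast
    moreover have "sat M (\<lambda>i. a ! index_of a (xs ! i)) \<phi> \<longleftrightarrow> holds M \<phi> xs"
      unfolding holds_def using \<phi> idx by (intro sat_cong) (auto simp: formulas_def)
    moreover have "sat M (\<lambda>i. a' ! index_of a (xs ! i)) \<phi> \<longleftrightarrow> holds M \<phi> (map f xs)"
      unfolding holds_def using \<phi> by (intro sat_cong) (auto simp: formulas_def f_def)
    ultimately show "holds M \<phi> xs = holds M \<phi> (map f xs)" by simp
  qed
  moreover have "|set a| <o \<kappa>" by (rule monster_finite[OF mon]) simp
  ultimately obtain \<sigma> where "\<sigma> \<in> Aut L M" "\<forall>x\<in>set a. \<sigma> x = f x"
    using mon unfolding monster_model_def strongly_homogeneous_def by blast
  moreover from this have "map \<sigma> a = a'" using mf by (metis map_cong)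
  ultimately show ?thesis by blast
qed

section \<open>Types\<close>

lemma formulas_simps [simp]:
  "Neg \<phi> \<in> formulas L n \<longleftrightarrow> \<phi> \<in> formulas L n"
  "Conj \<phi> \<psi> \<in> formulas L n \<longleftrightarrow> \<phi> \<in> formulas L n \<and> \<psi> \<in> formulas L n"
  by (auto simp: formulas_def)

lemma holds_simps [simp]:
  "holds M (Neg \<phi>) xs \<longleftrightarrow> \<not> holds M \<phi> xs"
  "holds M (Conj \<phi> \<psi>) xs \<longleftrightarrow> holds M \<phi> xs \<and> holds M \<psi> xs"
  by (auto simp: holds_def)

text \<open>Detached from \<open>types\<close> so that it can also be asked of incomplete sets of
  formulas on the way to a type.\<close>

definition fin_sat :: "('f, 'r, 'm) fo_struct \<Rightarrow> nat \<Rightarrow> ('f + 'm, 'r) fm set \<Rightarrow> bool" where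
  "fin_sat M n p \<longleftrightarrow> (\<forall>F. finite F \<and> F \<subseteq> p \<longrightarrow>
     (\<exists>xs. length xs = n \<and> set xs \<subseteq> dom M \<and> (\<forall>\<phi>\<in>F. holds (struct_over M) \<phi> xs)))"

lemma fin_satD:
  "fin_sat M n p \<Longrightarrow> finite F \<Longrightarrow> F \<subseteq> p \<Longrightarrow>
    \<exists>xs. length xs = n \<and> set xs \<subseteq> dom M \<and> (\<forall>\<phi>\<in>F. holds (struct_over M) \<phi> xs)"
  unfolding fin_sat_def by simp

lemma fin_sat_mono: "fin_sat M n p \<Longrightarrow> q \<subseteq> p \<Longrightarrow> fin_sat M n q"
  unfolding fin_sat_def by (meson order_trans)

lemma types_iff: "p \<in> types L M n A \<longleftrightarrow> p \<subseteq> formulas (lang_over L A) n \<and> fin_sat M n p \<and>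
    (\<forall>\<phi>\<in>formulas (lang_over L A) n. \<phi> \<in> p \<or> Neg \<phi> \<in> p)"
  by (simp add: types_def fin_sat_def)

lemma types_Neg:
  assumes "q \<in> types L M n A" "\<phi> \<in> formulas (lang_over L A) n"
  shows "Neg \<phi> \<in> q \<longleftrightarrow> \<phi> \<notin> q"
proof -
  have "\<not> (\<phi> \<in> q \<and> Neg \<phi> \<in> q)"
    using assms fin_satD[of M n q "{\<phi>, Neg \<phi>}"] by (auto simp: types_iff)
  then show ?thesis using assms by (auto simp: types_iff)
qed

lemma types_Conj:
  assumes q: "q \<in> types L M n A" and f: "\<phi> \<in> formulas (lang_over L A) n" "\<psi> \<in> formulas (lang_over L A) n"
  shows "Conj \<phi> \<psi> \<in> q \<longleftrightarrow> \<phi> \<in> q \<and> \<psi> \<in> q"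
proof -
  have fs: "fin_sat M n q" using q by (simp add: types_iff)
  have "\<not> (Conj \<phi> \<psi> \<in> q \<and> Neg \<phi> \<in> q)" "\<not> (Conj \<phi> \<psi> \<in> q \<and> Neg \<psi> \<in> q)"
    "\<not> (\<phi> \<in> q \<and> \<psi> \<in> q \<and> Neg (Conj \<phi> \<psi>) \<in> q)"
    using fin_satD[OF fs, of "{Conj \<phi> \<psi>, Neg \<phi>}"] fin_satD[OF fs, of "{Conj \<phi> \<psi>, Neg \<psi>}"]
      fin_satD[OF fs, of "{\<phi>, \<psi>, Neg (Conj \<phi> \<psi>)}"] by auto
  then show ?thesis using types_Neg[OF q] f by auto
qed

lemma types_subset_eq:
  assumes "p \<in> types L M n A" "q \<in> types L M n A" "p \<subseteq> q"
  shows "p = q"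
proof
  show "q \<subseteq> p"
  proof
    fix \<phi> assume \<phi>: "\<phi> \<in> q"
    then have "\<phi> \<in> formulas (lang_over L A) n" using assms(2) by (auto simp: types_iff)
    then show "\<phi> \<in> p" using types_Neg[OF assms(1)] types_Neg[OF assms(2)] \<phi> assms(3) by blast
  qed
qed fact

lemma tp_types:
  assumes "set xs \<subseteq> dom M"
  shows "tp L M A xs \<in> types L M (length xs) A"
  using assms by (auto simp: types_iff fin_sat_def tp_def)

lemma types_restrict:
  assumes "q \<in> types L M n A" "B \<subseteq> A"
  shows "q \<inter> formulas (lang_over L B) n \<in> types L M n B"
  unfolding types_iff
proof (intro conjI ballI)
  show "fin_sat M n (q \<inter> formulas (lang_over L B) n)"
    using assms by (auto simp: types_iff intro: fin_sat_mono)
  fix \<phi> assume "\<phi> \<in> formulas (lang_over L B) n"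
  then show "\<phi> \<in> q \<inter> formulas (lang_over L B) n \<or> Neg \<phi> \<in> q \<inter> formulas (lang_over L B) n"
    using assms formulas_mono[of B A L n] by (auto simp: types_iff)
qed simp

text \<open>If both extensions failed, on finite sets \<open>F\<close> and \<open>G\<close>, then a
  tuple satisfying what these contain of \<open>\<Gamma>\<close> would decide \<open>\<phi>\<close>
  and so satisfy all of \<open>F\<close> or all of \<open>G\<close>.\<close>

lemma fin_sat_insert:
  assumes "fin_sat M n \<Gamma>"
  shows "fin_sat M n (insert \<phi> \<Gamma>) \<or> fin_sat M n (insert (Neg \<phi>) \<Gamma>)"
proof (rule ccontr)
  assume "\<not> ?thesis"
  then obtain F G where F: "finite F" "F \<subseteq> insert \<phi> \<Gamma>"
      "\<not> (\<exists>xs. length xs = n \<and> set xs \<subseteq> dom M \<and> (\<forall>\<psi>\<in>F. holds (struct_over M) \<psi> xs))"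
    and G: "finite G" "G \<subseteq> insert (Neg \<phi>) \<Gamma>"
      "\<not> (\<exists>xs. length xs = n \<and> set xs \<subseteq> dom M \<and> (\<forall>\<psi>\<in>G. holds (struct_over M) \<psi> xs))"
    unfolding fin_sat_def by auto
  have "finite ((F - {\<phi>}) \<union> (G - {Neg \<phi>}))" "(F - {\<phi>}) \<union> (G - {Neg \<phi>}) \<subseteq> \<Gamma>"
    using F G by auto
  from fin_satD[OF assms this] obtain xs where xs: "length xs = n" "set xs \<subseteq> dom M"
    "\<forall>\<psi>\<in>(F - {\<phi>}) \<union> (G - {Neg \<phi>}). holds (struct_over M) \<psi> xs" by blast
  show False
  proof (cases "holds (struct_over M) \<phi> xs")
    case True
    then have "\<forall>\<psi>\<in>F. holds (struct_over M) \<psi> xs" using xs(3) by auto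
    then show ?thesis using F(3) xs(1,2) by auto
  next
    case False
    then have "holds (struct_over M) (Neg \<phi>) xs" by simp
    then have "\<forall>\<psi>\<in>G. holds (struct_over M) \<psi> xs"
      using xs(3) by (metis Diff_iff UnI2 singletonD)
    then show ?thesis using G(3) xs(1,2) by auto
  qed
qed

text \<open>Zorn's lemma gives a maximal finitely satisfiable set above \<open>\<Gamma>\<close>, and
  by \<open>fin_sat_insert\<close> a maximal one decides every formula.\<close>

lemma types_extend:
  assumes \<Gamma>: "\<Gamma> \<subseteq> formulas (lang_over L A) n" "fin_sat M n \<Gamma>"
  shows "\<exists>q\<in>types L M n A. \<Gamma> \<subseteq> q"
proof -
  define \<A> where "\<A> = {q. \<Gamma> \<subseteq> q \<and> q \<subseteq> formulas (lang_over L A) n \<and> fin_sat M n q}"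
  have "\<exists>q\<in>\<A>. \<forall>X\<in>\<A>. q \<subseteq> X \<longrightarrow> X = q"
  proof (rule subset_Zorn_nonempty)
    show "\<A> \<noteq> {}" using \<Gamma> by (auto simp: \<A>_def)
    fix \<C> assume C: "\<C> \<noteq> {}" "subset.chain \<A> \<C>"
    have sub: "\<C> \<subseteq> \<A>" using C by (auto simp: subset.chain_def)
    have "fin_sat M n (\<Union>\<C>)" unfolding fin_sat_def
    proof (intro allI impI)
      fix F assume "finite F \<and> F \<subseteq> \<Union>\<C>"
      then obtain q where "q \<in> \<C>" "F \<subseteq> q"
        using finite_subset_Union_chain[of F \<C> \<A>] C by blast
      then show "\<exists>xs. length xs = n \<and> set xs \<subseteq> dom M \<and> (\<forall>\<phi>\<in>F. holds (struct_over M) \<phi> xs)"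
        using sub fin_satD[of M n q F] \<open>finite F \<and> F \<subseteq> \<Union>\<C>\<close> by (auto simp: \<A>_def)
    qed
    then show "\<Union>\<C> \<in> \<A>" using C sub unfolding \<A>_def by blast
  qed
  then obtain q where q: "q \<in> \<A>" and max: "\<And>X. X \<in> \<A> \<Longrightarrow> q \<subseteq> X \<Longrightarrow> X = q" by blast
  have "\<phi> \<in> q \<or> Neg \<phi> \<in> q" if \<phi>: "\<phi> \<in> formulas (lang_over L A) n" for \<phi>
  proof -
    consider "fin_sat M n (insert \<phi> q)" | "fin_sat M n (insert (Neg \<phi>) q)"
      using q fin_sat_insert[of M n q \<phi>] by (auto simp: \<A>_def)
    then show ?thesis
    proof cases
      case 1
      then have "insert \<phi> q \<in> \<A>" using q \<phi> by (auto simp: \<A>_def)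
      then show ?thesis using max by blast
    next
      case 2
      then have "insert (Neg \<phi>) q \<in> \<A>" using q \<phi> by (auto simp: \<A>_def)
      then show ?thesis using max by blast
    qed
  qed
  then have "q \<in> types L M n A" using q by (auto simp: \<A>_def types_iff)
  then show ?thesis using q by (auto simp: \<A>_def)
qed

section \<open>The Stone space of global types\<close>

definition basic :: "('f, 'r) language \<Rightarrow> ('f, 'r, 'm) fo_struct \<Rightarrow> nat
    \<Rightarrow> ('f + 'm, 'r) fm set \<Rightarrow> ('f + 'm, 'r) fm \<Rightarrow> ('f + 'm, 'r) fm set set" where
  "basic L M n p \<phi> = {q \<in> global_types L M n p. \<phi> \<in> q}"

abbreviation basics :: "('f, 'r) language \<Rightarrow> ('f, 'r, 'm) fo_struct \<Rightarrow> nat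
    \<Rightarrow> ('f + 'm, 'r) fm set \<Rightarrow> ('f + 'm, 'r) fm set set set" where
  "basics L M n p \<equiv> basic L M n p ` formulas (lang_over L (dom M)) n"

lemma basic_Neg:
  "\<phi> \<in> formulas (lang_over L (dom M)) n \<Longrightarrow>
    basic L M n p (Neg \<phi>) = global_types L M n p - basic L M n p \<phi>"
  using types_Neg[of _ L M n "dom M" \<phi>] by (auto simp: basic_def global_types_def)

lemma basic_Conj:
  "\<phi> \<in> formulas (lang_over L (dom M)) n \<Longrightarrow> \<psi> \<in> formulas (lang_over L (dom M)) n \<Longrightarrow>
    basic L M n p (Conj \<phi> \<psi>) = basic L M n p \<phi> \<inter> basic L M n p \<psi>"
  using types_Conj[of _ L M n "dom M" \<phi> \<psi>] by (auto simp: basic_def global_types_def)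

lemma algebra_basics: "algebra (global_types L M n p) (basics L M n p)"
proof -
  \<comment> \<open>The quantifier removes the free variable, so this tautology is available even
    for \<open>n = 0\<close>; its conjunction with its negation defines the empty set.\<close>
  have e: "Exists (Equal (Var 0) (Var 0)) \<in> formulas (lang_over L (dom M)) n" (is "?e \<in> _")
    by (auto simp: formulas_def)
  have "basic L M n p (Conj ?e (Neg ?e)) = {}" using e by (simp add: basic_Conj basic_Neg)
  moreover have "Conj ?e (Neg ?e) \<in> formulas (lang_over L (dom M)) n" using e by simp
  ultimately have empty: "{} \<in> basics L M n p" by (metis image_eqI)
  have "basic L M n p \<phi> \<inter> basic L M n p \<psi> \<in> basics L M n p"
    if "\<phi> \<in> formulas (lang_over L (dom M)) n" "\<psi> \<in> formulas (lang_over L (dom M)) n" for \<phi> \<psi>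
    using that by (intro image_eqI[of _ _ "Conj \<phi> \<psi>"]) (auto simp: basic_Conj)
  moreover have "global_types L M n p - basic L M n p \<phi> \<in> basics L M n p"
    if "\<phi> \<in> formulas (lang_over L (dom M)) n" for \<phi>
    using that by (intro image_eqI[of _ _ "Neg \<phi>"]) (auto simp: basic_Neg)
  ultimately show ?thesis
    using empty by (auto simp: algebra_iff_Int basic_def)
qed

lemma type_space_eq: "type_space L M n p = topology_generated_by (basics L M n p)"
  unfolding type_space_def basic_def
    by (rule arg_cong[where f = "\<lambda>S. topology_generated_by S"]) auto

lemma topspace_type_space: "topspace (type_space L M n p) = global_types L M n p"
proof -
  interpret algebra "global_types L M n p" "basics L M n p" by (rule algebra_basics)
  show ?thesis unfolding type_space_eq using top by (auto simp: basic_def)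
qed

lemma openin_basic:
  "\<phi> \<in> formulas (lang_over L (dom M)) n \<Longrightarrow> openin (type_space L M n p) (basic L M n p \<phi>)"
  unfolding type_space_eq by (rule topology_generated_by_Basis) simp

text \<open>The topology is generated by \<open>basics\<close> as a subbase, and closure under
  intersection makes that subbase a base.\<close>

lemma type_space_base:
  assumes "openin (type_space L M n p) U" "q \<in> U"
  shows "\<exists>A\<in>basics L M n p. q \<in> A \<and> A \<subseteq> U"
proof -
  interpret algebra "global_types L M n p" "basics L M n p" by (rule algebra_basics)
  have "generate_topology_on (basics L M n p) U"
    using assms(1) by (simp add: type_space_eq openin_topology_generated_by_iff)
  then show ?thesis using assms(2)
  proof induction
    case (Int a b)
    then obtain A B where "A \<in> basics L M n p" "q \<in> A" "A \<subseteq> a" "B \<in> basics L M n p" "q \<in> B" "B \<subseteq> b"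
      by (metis IntE)
    then show ?case by (intro bexI[of _ "A \<inter> B"]) auto
  next
    case (UN K)
    then show ?case by (meson UnionE UnionI subset_eq)
  qed auto
qed

text \<open>A cover without a finite subcover would yield a type that avoids every basic set inside
  a member of the cover, and hence the whole cover.\<close>

lemma compact_type_space:
  assumes p: "p \<in> types L M n {}"
  shows "compact_space (type_space L M n p)"
  unfolding compact_space_alt topspace_type_space
proof (intro allI impI)
  fix \<U> assume U: "(\<forall>U\<in>\<U>. openin (type_space L M n p) U) \<and> global_types L M n p \<subseteq> \<Union>\<U>"
  show "\<exists>\<F>. finite \<F> \<and> \<F> \<subseteq> \<U> \<and> global_types L M n p \<subseteq> \<Union>\<F>"
  proof (rule ccontr)
    assume "\<not> ?thesis"
    then have neg: "\<not> global_types L M n p \<subseteq> \<Union>\<F>" if "finite \<F>" "\<F> \<subseteq> \<U>" for \<F>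
      using that by simp
    let ?fm = "formulas (lang_over L (dom M)) n"
    \<comment> \<open>A complete type containing \<open>\<Gamma>\<close> extends \<open>p\<close>
      and lies in no basic set that is contained in a member of the cover.\<close>
    define \<Gamma> where "\<Gamma> = p \<union> Neg ` {\<phi>\<in>?fm. \<exists>U\<in>\<U>. basic L M n p \<phi> \<subseteq> U}"
    have "p \<subseteq> ?fm" using p formulas_mono[of "{}" "dom M" L n] by (auto simp: types_iff)
    then have sub: "\<Gamma> \<subseteq> ?fm" by (auto simp: \<Gamma>_def)
    have "fin_sat M n \<Gamma>" unfolding fin_sat_def
    proof (intro allI impI)
      fix F assume F: "finite F \<and> F \<subseteq> \<Gamma>"
      define G where "G = {\<phi>\<in>?fm. Neg \<phi> \<in> F \<and> (\<exists>U\<in>\<U>. basic L M n p \<phi> \<subseteq> U)}"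
      have "Neg ` G \<subseteq> F" by (auto simp: G_def)
      then have "finite (Neg ` G)" using F finite_subset by blast
      then have fG: "finite G" by (rule finite_imageD) (auto simp: inj_on_def)
      obtain u where u: "\<And>\<phi>. \<phi> \<in> G \<Longrightarrow> u \<phi> \<in> \<U> \<and> basic L M n p \<phi> \<subseteq> u \<phi>"
      proof -
        have "\<forall>\<phi>\<in>G. \<exists>U. U \<in> \<U> \<and> basic L M n p \<phi> \<subseteq> U" by (auto simp: G_def)
        from bchoice[OF this] show ?thesis using that by blast
      qed
      \<comment> \<open>The finitely many members chosen for \<open>G\<close> miss some type
        \<open>q\<close> over \<open>p\<close>. This \<open>q\<close> contains all of
        \<open>F\<close>, which is therefore satisfiable.\<close>
      have "finite (u ` G)" "u ` G \<subseteq> \<U>" using fG u by auto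
      then obtain q where q: "q \<in> global_types L M n p" "q \<notin> \<Union>(u ` G)"
        using neg[of "u ` G"] by auto
      have qt: "q \<in> types L M n (dom M)" and pq: "p \<subseteq> q" using q by (auto simp: global_types_def)
      have "Neg \<phi> \<in> q" if "\<phi> \<in> G" for \<phi>
      proof -
        have "q \<notin> basic L M n p \<phi>" using u[OF that] q(2) that by blast
        then show ?thesis using q(1) that types_Neg[OF qt, of \<phi>] by (auto simp: basic_def G_def)
      qed
      then have "F \<subseteq> q" using F pq unfolding \<Gamma>_def G_def by blast
      then show "\<exists>xs. length xs = n \<and> set xs \<subseteq> dom M \<and> (\<forall>\<phi>\<in>F. holds (struct_over M) \<phi> xs)"
        using qt F fin_satD[of M n q F] by (simp add: types_iff)
    qed
    then obtain q where qt: "q \<in> types L M n (dom M)" and q: "\<Gamma> \<subseteq> q"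
      using types_extend[OF sub] by blast
    then have "q \<in> global_types L M n p" by (auto simp: global_types_def \<Gamma>_def)
    then obtain V where V: "V \<in> \<U>" "q \<in> V" using U by blast
    then obtain \<phi> where \<phi>: "\<phi> \<in> ?fm" "q \<in> basic L M n p \<phi>" "basic L M n p \<phi> \<subseteq> V"
      using type_space_base U by (metis (no_types, lifting) imageE)
    then have "Neg \<phi> \<in> \<Gamma>" using V(1) unfolding \<Gamma>_def by (intro UnI2 imageI) auto
    then have "Neg \<phi> \<in> q" using q by auto
    then show False using \<phi> types_Neg[OF qt \<phi>(1)] by (auto simp: basic_def)
  qed
qed

section \<open>The action of automorphisms on global types\<close>

lemma act_eq: "act \<sigma> q = param_fm \<sigma> ` q"
  by (simp add: act_def param_fm_def)

lemma act_inverse: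
  assumes "q \<subseteq> formulas (lang_over L A) n" "\<And>a. a \<in> A \<Longrightarrow> \<tau> (\<sigma> a) = a"
  shows "act \<tau> (act \<sigma> q) = q"
proof -
  have "param_fm \<tau> (param_fm \<sigma> \<phi>) = \<phi>" if "\<phi> \<in> q" for \<phi>
    unfolding param_fm_comp using assms that
    by (intro param_fm_ident[of L A]) (auto simp: formulas_def)
  then show ?thesis by (simp add: act_eq image_image)
qed

text \<open>Tuples satisfying finite parts are moved by \<open>\<sigma>\<close>, completeness is
  pulled back along the inverse, and \<open>p\<close> stays inside because its formulas have no
  parameters.\<close>

lemma act_global_types:
  assumes M: "is_struct L M" and \<sigma>: "\<sigma> \<in> Aut L M" and p: "p \<in> types L M n {}"
    and q: "q \<in> global_types L M n p"
  shows "act \<sigma> q \<in> global_types L M n p"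
proof -
  let ?fm = "formulas (lang_over L (dom M)) n"
  let ?\<tau> = "inv_into (dom M) \<sigma>"
  have bij: "bij_betw \<sigma> (dom M) (dom M)" using \<sigma> by (simp add: Aut_def)
  have \<tau>: "?\<tau> \<in> Aut L M" using Aut_inv[OF M \<sigma>] .
  have im: "\<sigma> ` dom M = dom M" "?\<tau> ` dom M = dom M"
    using \<sigma> \<tau> by (auto simp: Aut_def bij_betw_def)
  have qt: "q \<subseteq> ?fm" "fin_sat M n q" "\<And>\<phi>. \<phi> \<in> ?fm \<Longrightarrow> \<phi> \<in> q \<or> Neg \<phi> \<in> q" and pq: "p \<subseteq> q"
    using q by (auto simp: global_types_def types_iff)
  have "act \<sigma> q \<in> types L M n (dom M)" unfolding types_iff
  proof (intro conjI ballI)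
    show "act \<sigma> q \<subseteq> ?fm" using qt(1) param_formulas[of _ L "dom M" n \<sigma>] im by (auto simp: act_eq)
    show "fin_sat M n (act \<sigma> q)" unfolding fin_sat_def
    proof (intro allI impI)
      fix F assume "finite F \<and> F \<subseteq> act \<sigma> q"
      then obtain G where G: "finite G" "G \<subseteq> q" "F = param_fm \<sigma> ` G"
        unfolding act_eq by (meson finite_subset_image)
      obtain xs where xs: "length xs = n" "set xs \<subseteq> dom M" "\<forall>\<phi>\<in>G. holds (struct_over M) \<phi> xs"
        using fin_satD[OF qt(2) G(1,2)] by blast
      have "holds (struct_over M) (param_fm \<sigma> \<phi>) (map \<sigma> xs)" if "\<phi> \<in> G" for \<phi>
        using holds_param_fm[OF M order_refl \<sigma>, of \<phi> xs] xs that G qt(1) by auto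
      then show "\<exists>xs. length xs = n \<and> set xs \<subseteq> dom M \<and> (\<forall>\<phi>\<in>F. holds (struct_over M) \<phi> xs)"
        using G xs Aut_in_dom[OF \<sigma>] by (intro exI[of _ "map \<sigma> xs"]) auto
    qed
    fix \<phi> assume \<phi>: "\<phi> \<in> ?fm"
    then have "param_fm ?\<tau> \<phi> \<in> ?fm" using param_formulas[of \<phi> L "dom M" n ?\<tau>] im by auto
    moreover have "param_fm \<sigma> (param_fm ?\<tau> \<phi>) = \<phi>"
      unfolding param_fm_comp using \<phi> bij_betw_inv_into_right[OF bij]
      by (intro param_fm_ident[of L "dom M"]) (auto simp: formulas_def)
    ultimately show "\<phi> \<in> act \<sigma> q \<or> Neg \<phi> \<in> act \<sigma> q"
      using qt(3)[of "param_fm ?\<tau> \<phi>"] unfolding act_eq by (metis image_eqI param_fm_simps(3))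
  qed
  moreover have "p \<subseteq> act \<sigma> q"
  proof
    fix \<phi> assume \<phi>: "\<phi> \<in> p"
    then have "param_fm \<sigma> \<phi> = \<phi>"
      using p by (intro param_fm_ident[of L "{}"]) (auto simp: types_iff formulas_def)
    then show "\<phi> \<in> act \<sigma> q" using \<phi> pq unfolding act_eq by (metis image_eqI subsetD)
  qed
  ultimately show ?thesis by (simp add: global_types_def)
qed

lemma act_act_inv:
  assumes \<sigma>: "\<sigma> \<in> Aut L M" and q: "q \<in> global_types L M n p"
  shows "act \<sigma> (act (inv_into (dom M) \<sigma>) q) = q" "act (inv_into (dom M) \<sigma>) (act \<sigma> q) = q"
proof -
  have bij: "bij_betw \<sigma> (dom M) (dom M)" using \<sigma> by (simp add: Aut_def)
  have "q \<subseteq> formulas (lang_over L (dom M)) n" using q by (simp add: global_types_def types_iff)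
  then show "act \<sigma> (act (inv_into (dom M) \<sigma>) q) = q" "act (inv_into (dom M) \<sigma>) (act \<sigma> q) = q"
    using bij_betw_inv_into_left[OF bij] bij_betw_inv_into_right[OF bij]
    by (auto intro!: act_inverse)
qed

text \<open>Reduces the action on clopen sets to renaming in formulas. For the inclusion from right
  to left a type is pulled back by the inverse automorphism.\<close>

lemma act_basic:
  assumes M: "is_struct L M" and \<sigma>: "\<sigma> \<in> Aut L M" and p: "p \<in> types L M n {}"
    and \<phi>: "\<phi> \<in> formulas (lang_over L (dom M)) n"
  shows "act \<sigma> ` basic L M n p \<phi> = basic L M n p (param_fm \<sigma> \<phi>)"
proof (intro equalityI subsetI)
  fix q assume "q \<in> act \<sigma> ` basic L M n p \<phi>"
  then show "q \<in> basic L M n p (param_fm \<sigma> \<phi>)"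
    using act_global_types[OF M \<sigma> p] by (auto simp: basic_def) (simp add: act_eq)
next
  let ?\<tau> = "inv_into (dom M) \<sigma>"
  fix q assume q: "q \<in> basic L M n p (param_fm \<sigma> \<phi>)"
  have bij: "bij_betw \<sigma> (dom M) (dom M)" using \<sigma> by (simp add: Aut_def)
  have "param_fm ?\<tau> (param_fm \<sigma> \<phi>) = \<phi>"
    unfolding param_fm_comp using \<phi> bij_betw_inv_into_left[OF bij]
    by (intro param_fm_ident[of L "dom M"]) (auto simp: formulas_def)
  then have "\<phi> \<in> act ?\<tau> q"
    using q unfolding act_eq basic_def by (metis (no_types, lifting) image_eqI mem_Collect_eq)
  then have "act ?\<tau> q \<in> basic L M n p \<phi>"
    using q act_global_types[OF M Aut_inv[OF M \<sigma>] p] by (auto simp: basic_def)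
  moreover have "q = act \<sigma> (act ?\<tau> q)"
    using q act_act_inv(1)[OF \<sigma>, of q n p] by (auto simp: basic_def)
  ultimately show "q \<in> act \<sigma> ` basic L M n p \<phi>" by blast
qed

lemma bij_betw_act:
  assumes M: "is_struct L M" and \<sigma>: "\<sigma> \<in> Aut L M" and p: "p \<in> types L M n {}"
  shows "bij_betw (act \<sigma>) (global_types L M n p) (global_types L M n p)"
  using act_act_inv[OF \<sigma>] act_global_types[OF M \<sigma> p] act_global_types[OF M Aut_inv[OF M \<sigma>] p]
  by (intro bij_betw_byWitness[where f' = "act (inv_into (dom M) \<sigma>)"]) auto

section \<open>From amenability to the strong DEECRP\<close>

text \<open>\<open>pat q\<close> records which of the sets \<open>E j\<close> contain
  \<open>q\<close>, and \<open>W V\<close> is the atom with pattern \<open>V\<close>. Patterns are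
  taken from the image of \<open>pat\<close>, so every listed atom has a point; in the application
  this point is a type to be realised.\<close>

lemma (in prob_space) prob_eq_sum_atoms:
  fixes E :: "'i \<Rightarrow> 'a set"
  assumes J: "finite J" and E: "\<And>j. j \<in> J \<Longrightarrow> E j \<in> events"
  defines "pat \<equiv> \<lambda>q. {j\<in>J. q \<in> E j}"
  defines "W \<equiv> \<lambda>V. {q\<in>space M. pat q = V}"
  shows "(\<Sum>V\<in>pat ` space M. prob (W V)) = 1"
    and "j \<in> J \<Longrightarrow> (\<Sum>V\<in>pat ` space M. prob (W V) * (if j \<in> V then 1 else 0)) = prob (E j)"
proof -
  have fin: "finite (pat ` space M)"
    using J by (rule finite_subset[rotated, OF finite_Pow_iff[THEN iffD2]]) (auto simp: pat_def)
  have W: "W V \<in> events" if "V \<subseteq> J" for V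
  proof -
    have "{q\<in>space M. q \<in> E j \<longleftrightarrow> j \<in> V} \<in> events" if j: "j \<in> J" for j
    proof (cases "j \<in> V")
      case True
      then have "{q\<in>space M. q \<in> E j \<longleftrightarrow> j \<in> V} = E j" using sets.sets_into_space[OF E[OF j]] by auto
      then show ?thesis using E[OF j] by simp
    next
      case False
      then have "{q\<in>space M. q \<in> E j \<longleftrightarrow> j \<in> V} = space M - E j" by auto
      then show ?thesis using E[OF j] by auto
    qed
    then have "{q\<in>space M. \<forall>j\<in>J. q \<in> E j \<longleftrightarrow> j \<in> V} \<in> events"
      using J by (intro sets.sets_Collect_finite_All) auto
    moreover have "W V = {q\<in>space M. \<forall>j\<in>J. q \<in> E j \<longleftrightarrow> j \<in> V}"
      using that by (auto simp: W_def pat_def)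
    ultimately show ?thesis by simp
  qed
  have Un: "prob (\<Union>V\<in>I. W V) = (\<Sum>V\<in>I. prob (W V))" if "I \<subseteq> pat ` space M" for I
    using that fin W
   
      by (intro finite_measure_finite_Union) (auto simp: finite_subset disjoint_family_on_def W_def pat_def)
  have "(\<Union>V\<in>pat ` space M. W V) = space M" by (auto simp: W_def)
  then show "(\<Sum>V\<in>pat ` space M. prob (W V)) = 1" using Un[of "pat ` space M"] prob_space by simp
  assume j: "j \<in> J"
  have "(\<Union>V\<in>{V\<in>pat ` space M. j \<in> V}. W V) = E j"
    using j sets.sets_into_space[OF E[OF j]] by (auto simp: W_def pat_def)
  then have "prob (E j) = (\<Sum>V\<in>{V\<in>pat ` space M. j \<in> V}. prob (W V))"
    using Un[of "{V\<in>pat ` space M. j \<in> V}"] by auto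
  also have "\<dots> = (\<Sum>V\<in>pat ` space M. if j \<in> V then prob (W V) else 0)"
    using fin by (simp add: sum.inter_filter)
  also have "\<dots> = (\<Sum>V\<in>pat ` space M. prob (W V) * (if j \<in> V then 1 else 0))"
    by (intro sum.cong) auto
  finally show "(\<Sum>V\<in>pat ` space M. prob (W V) * (if j \<in> V then 1 else 0)) = prob (E j)" by simp
qed

section \<open>Realisation of types in the monster model\<close>

lemma monster_realize:
  assumes mon: "monster_model L T \<kappa> M" and p: "p \<in> types L M n A" and A: "finite A" "A \<subseteq> dom M"
  shows "\<exists>xs. length xs = n \<and> set xs \<subseteq> dom M \<and> tp L M A xs = p"
  using mon p A monster_finite[OF mon A(1)] unfolding monster_model_def saturated_def by blast

text \<open>Saturation realises the restriction of \<open>q\<close> to the finite set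
  \<open>B\<close>. The realisation has the same type over the empty set as \<open>d\<close>, so by
  homogeneity it is an image of \<open>d\<close>.\<close>

lemma global_type_realize:
  assumes mon: "monster_model L T \<kappa> M" and d: "set d \<subseteq> dom M" and B: "finite B" "B \<subseteq> dom M"
    and q: "q \<in> global_types L M (length d) (tp L M {} d)"
  shows "\<exists>\<tau>\<in>Aut L M. \<forall>\<psi>\<in>formulas (lang_over L B) (length d).
    \<psi> \<in> q \<longleftrightarrow> holds (struct_over M) \<psi> (map \<tau> d)"
proof -
  have qt: "q \<in> types L M (length d) (dom M)" and pq: "tp L M {} d \<subseteq> q"
    using q by (auto simp: global_types_def)
  have "q \<inter> formulas (lang_over L B) (length d) \<in> types L M (length d) B"
    using types_restrict[OF qt B(2)] .
  then obtain xs where xs: "length xs = length d" "set xs \<subseteq> dom M"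
    "tp L M B xs = q \<inter> formulas (lang_over L B) (length d)"
    using monster_realize[OF mon _ B] by blast
  have "tp L M {} d \<subseteq> tp L M {} xs"
  proof
    fix \<phi> assume \<phi>: "\<phi> \<in> tp L M {} d"
    then have f: "\<phi> \<in> formulas (lang_over L {}) (length d)" by (simp add: tp_def)
    then have "\<phi> \<in> tp L M B xs"
      using xs(3) \<phi> pq formulas_mono[of "{}" B L "length d"] by auto
    then show "\<phi> \<in> tp L M {} xs" using f xs(1) by (simp add: tp_def)
  qed
  then have "tp L M {} xs = tp L M {} d"
    using types_subset_eq tp_types[OF d] tp_types[OF xs(2)] xs(1) by metis
  then obtain \<tau> where \<tau>: "\<tau> \<in> Aut L M" "map \<tau> d = xs"
    using monster_homogeneous[OF mon d xs(2,1)] by blast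
  have "\<psi> \<in> q \<longleftrightarrow> holds (struct_over M) \<psi> (map \<tau> d)"
    if "\<psi> \<in> formulas (lang_over L B) (length d)" for \<psi>
  proof -
    have "\<psi> \<in> tp L M B xs \<longleftrightarrow> \<psi> \<in> q" using xs(3) that by simp
    then show ?thesis using that xs(1) \<tau>(2) by (simp add: tp_def)
  qed
  then show ?thesis using \<tau>(1) by blast
qed

section \<open>The convex combination attached to an invariant measure\<close>

lemma amenable_imp_strong_DEECRP:
  assumes mon: "monster_model L T \<kappa> M" and am: "amenable L M"
  shows "strong_DEECRP L M"
  unfolding strong_DEECRP_def convex_ramsey_def
proof (intro allI impI)
  fix a b n c
  assume "set a \<subseteq> set b \<and> set b \<subseteq> dom M \<and> definable_coloring L M a n c"
  then have ab: "set a \<subseteq> set b" and b: "set b \<subseteq> dom M" and dc: "definable_coloring L M a n c"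
    by auto
  have M: "is_struct L M" using mon by (simp add: monster_model_def is_model_def)
  obtain \<phi> where \<phi>: "\<And>i. i < n \<Longrightarrow> \<phi> i \<in> formulas (lang_over L (dom M)) (length a)"
    and c\<phi>: "\<And>i x. i < n \<Longrightarrow> x \<in> copies L M (dom M) a \<Longrightarrow>
      c x i = 1 \<longleftrightarrow> holds (struct_over M) (\<phi> i) x"
    using dc unfolding definable_coloring_def by blast
  have c01: "c x i \<in> {0, 1}" if "i < n" "x \<in> copies L M (dom M) a" for i x
    using dc that unfolding definable_coloring_def by blast
  obtain d where d: "set d \<subseteq> dom M"
    and \<phi>d: "\<And>i. i < n \<Longrightarrow> \<phi> i \<in> formulas (lang_over L (set d)) (length a)"
    using formulas_finite_params[of "{..<n}" \<phi> L "dom M" "length a"] \<phi> by auto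
  define p where "p = tp L M {} d"
  have p: "p \<in> types L M (length d) {}" unfolding p_def by (rule tp_types[OF d])
  obtain \<mu> where \<mu>: "regular_borel_prob (type_space L M (length d) p) \<mu>"
    and inv: "\<And>\<sigma> B. \<sigma> \<in> Aut L M \<Longrightarrow> B \<in> sets \<mu> \<Longrightarrow> emeasure \<mu> (act \<sigma> ` B) = emeasure \<mu> B"
    using am p unfolding amenable_def by blast
  interpret prob_space \<mu> using \<mu> by (simp add: regular_borel_prob_def)
  have sp: "space \<mu> = global_types L M (length d) p"
    using \<mu> by (simp add: regular_borel_prob_def topspace_type_space)
  define C where "C = copies L M (set b) a"
  have C: "set x \<subseteq> set b" "length x = length a" "tp L M {} x = tp L M {} a" if "x \<in> C" for x
    using that by (auto simp: C_def copies_def)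
  have "C \<subseteq> {x. set x \<subseteq> set b \<and> length x = length a}" using C by auto
  then have finC: "finite C" using finite_lists_length_eq[of "set b"] finite_subset by blast
  define J where "J = C \<times> {..<n}"
  have finJ: "finite J" using finC by (simp add: J_def)
  \<comment> \<open>This is the formula \<open>\<phi> i\<close> with \<open>x\<close> put in for its
    variables and new variables in place of \<open>d\<close>; its parameters lie in
    \<open>b\<close>.\<close>
  define \<psi> where "\<psi> = (\<lambda>(x, i). swap x d (\<phi> i))"
  define E where "E j = basic L M (length d) p (\<psi> j)" for j
  have \<psi>: "\<psi> j \<in> formulas (lang_over L (set b)) (length d)" if "j \<in> J" for j
  proof -
    obtain x i where j: "j = (x, i)" by force
    have "swap x d (\<phi> i) \<in> formulas (lang_over L (set x)) (length d)"
      using that j \<phi>d[of i] C[of x] by (intro swap_formulas) (auto simp: J_def)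
    then show ?thesis using that j C[of x] formulas_mono[of "set x" "set b" L "length d"]
      by (auto simp: J_def \<psi>_def)
  qed
  have \<psi>': "\<psi> j \<in> formulas (lang_over L (dom M)) (length d)" if "j \<in> J" for j
    using \<psi>[OF that] formulas_mono[OF b] by blast
  have E: "E j \<in> events" if "j \<in> J" for j
    using \<mu> openin_basic[OF \<psi>'[OF that], of p] by (auto simp: regular_borel_prob_def E_def)
  define pat where "pat q = {j\<in>J. q \<in> E j}" for q
  define W where "W V = {q\<in>space \<mu>. pat q = V}" for V
  note atoms = prob_eq_sum_atoms[of J E, OF finJ E, folded pat_def W_def]
  let ?I = "pat ` space \<mu>"
  have finI: "finite ?I"
    using finJ by (rule finite_subset[rotated, OF finite_Pow_iff[THEN iffD2]]) (auto simp: pat_def)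
  have "\<exists>\<sigma>\<in>Aut L M. \<forall>x\<in>C. \<forall>i<n. real (c (map \<sigma> x) i) = (if (x, i) \<in> V then 1 else 0)"
    if V: "V \<in> ?I" for V
  proof -
    obtain q where q: "q \<in> global_types L M (length d) p" "V = pat q" using V sp by auto
    obtain \<tau> where \<tau>: "\<tau> \<in> Aut L M" and real: "\<And>\<psi>. \<psi> \<in> formulas (lang_over L (set b)) (length d) \<Longrightarrow>
        \<psi> \<in> q \<longleftrightarrow> holds (struct_over M) \<psi> (map \<tau> d)"
      using global_type_realize[OF mon d _ b q(1)[unfolded p_def]] by auto
    \<comment> \<open>By \<open>holds_swap\<close>, color \<open>i\<close> of the preimage of
      \<open>x\<close> under \<open>\<tau>\<close> is the truth of \<open>\<psi> (x, i)\<close> at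
      \<open>map \<tau> d\<close>, that is, its membership in \<open>q\<close>.\<close>
    let ?\<sigma> = "inv_into (dom M) \<tau>"
    have \<sigma>: "?\<sigma> \<in> Aut L M" by (rule Aut_inv[OF M \<tau>])
    have "real (c (map ?\<sigma> x) i) = (if (x, i) \<in> V then 1 else 0)" if x: "x \<in> C" and i: "i < n" for x i
    proof -
      have xd: "set x \<subseteq> dom M" using C(1)[OF x] b by simp
      have mx: "map \<tau> (map ?\<sigma> x) = x" by (rule map_inv_Aut(1)[OF \<tau> xd])
      have sd: "set (map ?\<sigma> x) \<subseteq> dom M" using xd Aut_in_dom[OF \<sigma>] by auto
      have xi: "(x, i) \<in> J" using x i by (simp add: J_def)
      have "(x, i) \<in> V \<longleftrightarrow> \<psi> (x, i) \<in> q" using xi q by (auto simp: pat_def E_def basic_def)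
      also have "\<dots> \<longleftrightarrow> holds (struct_over M) (\<psi> (x, i)) (map \<tau> d)" by (rule real[OF \<psi>[OF xi]])
      also have "\<dots> \<longleftrightarrow> holds (struct_over M) (\<phi> i) (map ?\<sigma> x)"
        using holds_swap[OF M \<tau> d sd, of "\<phi> i"] mx \<phi>d[OF i] C(2)[OF x] by (simp add: \<psi>_def)
      also have "\<dots> \<longleftrightarrow> c (map ?\<sigma> x) i = 1"
      proof -
        have "map ?\<sigma> x \<in> copies L M (dom M) a"
          using sd C[OF x] tp_Aut[OF M \<sigma> xd] by (simp add: copies_def)
        then show ?thesis using c\<phi>[OF i] by simp
      qed
      finally have "(x, i) \<in> V \<longleftrightarrow> c (map ?\<sigma> x) i = 1" .
      moreover have "c (map ?\<sigma> x) i \<in> {0, 1}"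
        using i sd C[OF x] tp_Aut[OF M \<sigma> xd] by (intro c01) (simp_all add: copies_def)
      ultimately show ?thesis by auto
    qed
    then show ?thesis using \<sigma> by blast
  qed
  then obtain \<sigma> where \<sigma>: "\<And>V. V \<in> ?I \<Longrightarrow> \<sigma> V \<in> Aut L M"
    and c\<sigma>: "\<And>V x i. V \<in> ?I \<Longrightarrow> x \<in> C \<Longrightarrow> i < n \<Longrightarrow>
      real (c (map (\<sigma> V) x) i) = (if (x, i) \<in> V then 1 else 0)"
    by metis
  \<comment> \<open>The atoms are numbered, as weights and automorphisms have to be indexed by
    \<open>j < k\<close>.\<close>
  obtain h where h: "bij_betw h {0..<card ?I} ?I" using ex_bij_betw_nat_finite[OF finI] by blast
  let ?k = "card ?I" and ?w = "\<lambda>j. prob (W (h j))" and ?s = "\<lambda>j. \<sigma> (h j)"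
  have reindex: "(\<Sum>j<?k. g (h j)) = (\<Sum>V\<in>?I. g V)" for g :: "_ \<Rightarrow> real"
    using sum.reindex_bij_betw[OF h, of g] by (simp add: lessThan_atLeast0)
  have hI: "h j \<in> ?I" if "j < ?k" for j using bij_betwE[OF h] that by simp
  \<comment> \<open>Each atom contributes its measure exactly when its pattern contains
    \<open>(x, i)\<close>, so the average color is the measure of \<open>E (x, i)\<close>.\<close>
  have sumE: "(\<Sum>j<?k. ?w j * real (c (map (?s j) x) i)) = prob (E (x, i))" if "x \<in> C" "i < n" for x i
  proof -
    have "(\<Sum>j<?k. ?w j * real (c (map (?s j) x) i)) =
        (\<Sum>j<?k. prob (W (h j)) * (if (x, i) \<in> h j then 1 else 0))"
      using c\<sigma>[OF hI] that by (intro sum.cong) auto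
    also have "\<dots> = prob (E (x, i))"
      using reindex[of "\<lambda>V. prob (W V) * (if (x, i) \<in> V then 1 else 0)"] atoms(2)[of "(x, i)"] that
      by (simp add: J_def)
    finally show ?thesis .
  qed
  \<comment> \<open>Two copies of \<open>a\<close> are conjugate, and an automorphism from
    \<open>x\<close> to \<open>y\<close> carries \<open>E (x, i)\<close> to \<open>E (y, i)\<close>.
    Invariance gives exact equality, hence the bound 0.\<close>
  have probE: "prob (E (x, i)) = prob (E (y, i))" if x: "x \<in> C" and y: "y \<in> C" and i: "i < n" for x y i
  proof -
    have "set x \<subseteq> dom M" "set y \<subseteq> dom M" using C(1)[OF x] C(1)[OF y] b by auto
    then obtain \<sigma> where \<sigma>: "\<sigma> \<in> Aut L M" "map \<sigma> x = y"
      using monster_homogeneous[OF mon, of x y] C[OF x] C[OF y] by auto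
    have xi: "(x, i) \<in> J" using x i by (simp add: J_def)
    have "act \<sigma> ` E (x, i) = basic L M (length d) p (param_fm \<sigma> (\<psi> (x, i)))"
      unfolding E_def by (rule act_basic[OF M \<sigma>(1) p \<psi>'[OF xi]])
    also have "param_fm \<sigma> (\<psi> (x, i)) = \<psi> (y, i)"
      using param_swap[of "\<phi> i" _ x \<sigma> d] \<phi>[OF i] C(2)[OF x] \<sigma>(2) by (simp add: \<psi>_def)
    finally have "act \<sigma> ` E (x, i) = E (y, i)" by (simp add: E_def)
    then show ?thesis using inv[OF \<sigma>(1) E[OF xi]] by (simp add: measure_def)
  qed
  show "\<exists>(k::nat) (w :: nat \<Rightarrow> real) \<sigma>. (\<forall>j<k. w j \<in> {0..1}) \<and> (\<Sum>j<k. w j) = 1 \<and>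
      (\<forall>j<k. \<sigma> j \<in> Aut L M) \<and>
      (\<forall>a'\<in>copies L M (set b) a. \<forall>a''\<in>copies L M (set b) a. \<forall>i<n.
         \<bar>(\<Sum>j<k. w j * real (c (map (\<sigma> j) a') i)) -
          (\<Sum>j<k. w j * real (c (map (\<sigma> j) a'') i))\<bar> \<le> 0)"
  proof (intro exI[of _ ?k] exI[of _ ?w] exI[of _ ?s] conjI)
    show "\<forall>j<?k. ?w j \<in> {0..1}" by simp
    show "(\<Sum>j<?k. ?w j) = 1" using reindex[of "\<lambda>V. prob (W V)"] atoms(1) by simp
    show "\<forall>j<?k. ?s j \<in> Aut L M" using \<sigma> hI by blast
    show "\<forall>a'\<in>copies L M (set b) a. \<forall>a''\<in>copies L M (set b) a. \<forall>i<n.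
       \<bar>(\<Sum>j<?k. ?w j * real (c (map (?s j) a') i)) -
        (\<Sum>j<?k. ?w j * real (c (map (?s j) a'') i))\<bar> \<le> 0"
    proof (intro ballI allI impI)
      fix x y i assume "x \<in> copies L M (set b) a" "y \<in> copies L M (set b) a" "i < n"
      then have "x \<in> C" "y \<in> C" "i < n" by (simp_all add: C_def)
      then show "\<bar>(\<Sum>j<?k. ?w j * real (c (map (?s j) x) i)) -
        (\<Sum>j<?k. ?w j * real (c (map (?s j) y) i))\<bar> \<le> 0"
        using sumE[of x i] sumE[of y i] probE[of x y i] by simp
    qed
  qed
qed

section \<open>From the DEECRP to amenability\<close>

abbreviation def_set :: "('f, 'r) language \<Rightarrow> ('f, 'r, 'm) fo_struct \<Rightarrow> 'm list
    \<Rightarrow> ('f + 'm, 'r) fm \<Rightarrow> 'm list set" where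
  "def_set L M a \<phi> \<equiv> {x \<in> copies L M (dom M) a. holds (struct_over M) \<phi> x}"

lemma convex_ramseyD:
  assumes "convex_ramsey \<epsilon> L M" "set a \<subseteq> set b" "set b \<subseteq> dom M" "definable_coloring L M a n c"
  shows "\<exists>(k::nat) (w :: nat \<Rightarrow> real) \<sigma>.
    (\<forall>j<k. w j \<in> {0..1}) \<and> (\<Sum>j<k. w j) = 1 \<and> (\<forall>j<k. \<sigma> j \<in> Aut L M) \<and>
    (\<forall>a'\<in>copies L M (set b) a. \<forall>a''\<in>copies L M (set b) a. \<forall>i<n.
       \<bar>(\<Sum>j<k. w j * real (c (map (\<sigma> j) a') i)) -
        (\<Sum>j<k. w j * real (c (map (\<sigma> j) a'') i))\<bar> \<le> \<epsilon>)"
  using assms(1)[unfolded convex_ramsey_def, THEN spec, THEN spec, THEN spec, THEN spec, THEN mp,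
      of a b n c] assms(2-4) by simp

lemma convex_ramsey_mono:
  assumes "convex_ramsey \<epsilon> L M" "\<epsilon> \<le> \<delta>"
  shows "convex_ramsey \<delta> L M"
  unfolding convex_ramsey_def
proof (intro allI impI)
  fix a b n c
  assume "set a \<subseteq> set b \<and> set b \<subseteq> dom M \<and> definable_coloring L M a n c"
  then obtain k w \<sigma> where w: "\<forall>j<k. w j \<in> {0..1::real}" "(\<Sum>j<(k::nat). w j) = 1"
    and \<sigma>: "\<forall>j<k. \<sigma> j \<in> Aut L M"
    and le: "\<forall>a'\<in>copies L M (set b) a. \<forall>a''\<in>copies L M (set b) a. \<forall>i<n.
       \<bar>(\<Sum>j<k. w j * real (c (map (\<sigma> j) a') i)) -
        (\<Sum>j<k. w j * real (c (map (\<sigma> j) a'') i))\<bar> \<le> \<epsilon>"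
    using convex_ramseyD[OF assms(1), of a b n c] by blast
  have "\<forall>a'\<in>copies L M (set b) a. \<forall>a''\<in>copies L M (set b) a. \<forall>i<n.
       \<bar>(\<Sum>j<k. w j * real (c (map (\<sigma> j) a') i)) -
        (\<Sum>j<k. w j * real (c (map (\<sigma> j) a'') i))\<bar> \<le> \<delta>"
    using assms(2) by (intro ballI allI impI) (rule order_trans[OF le[rule_format]])
  with w \<sigma> show "\<exists>(k::nat) (w :: nat \<Rightarrow> real) \<sigma>.
    (\<forall>j<k. w j \<in> {0..1}) \<and> (\<Sum>j<k. w j) = 1 \<and> (\<forall>j<k. \<sigma> j \<in> Aut L M) \<and>
    (\<forall>a'\<in>copies L M (set b) a. \<forall>a''\<in>copies L M (set b) a. \<forall>i<n.
       \<bar>(\<Sum>j<k. w j * real (c (map (\<sigma> j) a') i)) -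
        (\<Sum>j<k. w j * real (c (map (\<sigma> j) a'') i))\<bar> \<le> \<delta>)"
    by blast
qed

text \<open>The coloring is put on the copies of the parameter tuple \<open>d\<close> rather than of
  \<open>a\<close>. Each point \<open>x j\<close> is the preimage of \<open>a\<close> under an
  automorphism from the Ramsey property, so the color of the image of \<open>d\<close> becomes the
  truth of a formula over \<open>d\<close> at \<open>x j\<close>.\<close>

lemma DEECRP_approx:
  assumes M: "is_struct L M" and ram: "convex_ramsey \<epsilon> L M" and a: "set a \<subseteq> dom M"
    and \<Phi>: "finite \<Phi>" "\<Phi> \<subseteq> formulas (lang_over L (dom M)) (length a)"
    and S: "finite S" "S \<subseteq> Aut L M"
  shows "\<exists>(k::nat) (w :: nat \<Rightarrow> real) x. (\<forall>j<k. w j \<in> {0..1}) \<and> (\<Sum>j<k. w j) = 1 \<and>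
    (\<forall>j<k. x j \<in> copies L M (dom M) a) \<and>
    (\<forall>\<phi>\<in>\<Phi>. \<forall>\<sigma>\<in>S. \<bar>(\<Sum>j<k. w j * indicator (def_set L M a \<phi>) (x j)) -
       (\<Sum>j<k. w j * indicator (def_set L M a (param_fm \<sigma> \<phi>)) (x j))\<bar> \<le> \<epsilon>)"
proof -
  obtain fs where fs: "set fs = \<Phi>" using finite_list[OF \<Phi>(1)] by blast
  obtain ss where ss: "set ss = S" using finite_list[OF S(1)] by blast
  obtain d where d: "set d \<subseteq> dom M" and \<Phi>d: "\<And>\<phi>. \<phi> \<in> \<Phi> \<Longrightarrow> \<phi> \<in> formulas (lang_over L (set d)) (length a)"
    using formulas_finite_params[of \<Phi> "\<lambda>\<phi>. \<phi>" L "dom M" "length a"] \<Phi> by blast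
  define n where "n = length fs"
  have fsn: "fs ! i \<in> \<Phi>" if "i < n" for i using that fs by (auto simp: n_def)
  define c :: "'c list \<Rightarrow> nat \<Rightarrow> nat"
    where "c z i = (if holds (struct_over M) (swap a d (fs ! i)) z then 1 else 0)" for z i
  \<comment> \<open>Lists \<open>d\<close> and its images under \<open>S\<close>. These are copies
    of \<open>d\<close> in \<open>b\<close>, and comparing \<open>d\<close> with each image yields
    the almost invariance.\<close>
  define b where "b = d @ concat (map (\<lambda>\<sigma>. map \<sigma> d) ss)"
  have b: "set b \<subseteq> dom M" using d ss S(2) Aut_in_dom by (fastforce simp: b_def)
  have "swap a d (fs ! i) \<in> formulas (lang_over L (dom M)) (length d)" if "i < n" for i
    using swap_formulas[OF \<Phi>d[OF fsn[OF that]]] formulas_mono[OF a] by blast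
  then have dc: "definable_coloring L M d n c"
    unfolding definable_coloring_def
    by (intro conjI exI[of _ "\<lambda>i. swap a d (fs ! i)"]) (auto simp: c_def)
  have "set d \<subseteq> set b" by (simp add: b_def)
  then obtain k w \<tau> where w: "\<forall>j<k. w j \<in> {0..1::real}" "(\<Sum>j<(k::nat). w j) = 1"
    and \<tau>': "\<forall>j<k. \<tau> j \<in> Aut L M"
    and ramsey: "\<forall>y\<in>copies L M (set b) d. \<forall>z\<in>copies L M (set b) d. \<forall>i<n.
      \<bar>(\<Sum>j<k. w j * real (c (map (\<tau> j) y) i)) - (\<Sum>j<k. w j * real (c (map (\<tau> j) z) i))\<bar> \<le> \<epsilon>"
    using convex_ramseyD[OF ram _ b dc] by blast
  have \<tau>: "\<tau> j \<in> Aut L M" if "j < k" for j using \<tau>' that by simp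
  define x where "x j = map (inv_into (dom M) (\<tau> j)) a" for j
  have x: "x j \<in> copies L M (dom M) a" "set (x j) \<subseteq> dom M" "map (\<tau> j) (x j) = a" if "j < k" for j
  proof -
    have i: "inv_into (dom M) (\<tau> j) \<in> Aut L M" by (rule Aut_inv[OF M \<tau>[OF that]])
    show s: "set (x j) \<subseteq> dom M" using a Aut_in_dom[OF i] by (auto simp: x_def)
    show "x j \<in> copies L M (dom M) a"
      using s tp_Aut[OF M i a] by (simp add: copies_def x_def)
    show "map (\<tau> j) (x j) = a" unfolding x_def by (rule map_inv_Aut(1)[OF \<tau>[OF that] a])
  qed
  have ind1: "real (c (map (\<tau> j) d) i) = indicator (def_set L M a (fs ! i)) (x j)"
    if j: "j < k" and i: "i < n" for i j
    using holds_swap[OF M \<tau>[OF j] d x(2)[OF j], of "fs ! i"] \<Phi>d[OF fsn[OF i]] x[OF j]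
    by (simp add: c_def indicator_def x_def)
  have ind2: "real (c (map (\<tau> j) (map \<sigma> d)) i) = indicator (def_set L M a (param_fm \<sigma> (fs ! i))) (x j)"
    if j: "j < k" and i: "i < n" and \<sigma>: "\<sigma> \<in> S" for i j \<sigma>
  proof -
    have \<sigma>A: "\<sigma> \<in> Aut L M" using \<sigma> S by blast
    \<comment> \<open>Since \<open>y\<close> is the preimage of \<open>a\<close> under the composite
      of \<open>\<sigma>\<close> and \<open>\<tau> j\<close>, the exchange lemma reads the color off
      at \<open>y\<close>; renaming by \<open>\<sigma>\<close> then moves the statement back to
      \<open>x j\<close>.\<close>
    define y where "y = map (inv_into (dom M) \<sigma>) (x j)"
    have y: "map \<sigma> y = x j" unfolding y_def by (rule map_inv_Aut(1)[OF \<sigma>A x(2)[OF j]])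
    have yd: "set y \<subseteq> dom M" using x(2)[OF j] Aut_in_dom[OF Aut_inv[OF M \<sigma>A]] by (auto simp: y_def)
    have len: "length y = length a" by (simp add: y_def x_def)
    have a_eq: "a = map (\<tau> j \<circ> \<sigma>) y" using y x(3)[OF j] by (simp flip: map_map)
    have "holds (struct_over M) (swap a d (fs ! i)) (map (\<tau> j \<circ> \<sigma>) d) \<longleftrightarrow> holds (struct_over M) (fs ! i) y"
      using holds_swap[OF M Aut_comp[OF M \<sigma>A \<tau>[OF j]] d yd, of "fs ! i"] \<Phi>d[OF fsn[OF i]] len
      by (simp flip: a_eq)
    also have "\<dots> \<longleftrightarrow> holds (struct_over M) (param_fm \<sigma> (fs ! i)) (x j)"
      using holds_param_fm[OF M order_refl \<sigma>A, of "fs ! i" y] fsn[OF i] \<Phi>(2) len yd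
      by (auto simp: y)
    finally show ?thesis using x(1)[OF j] by (simp add: c_def indicator_def)
  qed
  have "\<bar>(\<Sum>j<k. w j * indicator (def_set L M a \<phi>) (x j)) -
      (\<Sum>j<k. w j * indicator (def_set L M a (param_fm \<sigma> \<phi>)) (x j))\<bar> \<le> \<epsilon>"
    if \<phi>: "\<phi> \<in> \<Phi>" and \<sigma>: "\<sigma> \<in> S" for \<phi> \<sigma>
  proof -
    obtain i where i: "i < n" "fs ! i = \<phi>" using \<phi> fs by (auto simp: n_def in_set_conv_nth)
    have \<sigma>A: "\<sigma> \<in> Aut L M" using \<sigma> S by blast
    have "d \<in> copies L M (set b) d" by (simp add: copies_def b_def)
    moreover have "map \<sigma> d \<in> copies L M (set b) d"
      using tp_Aut[OF M \<sigma>A d] \<sigma> ss by (auto simp: copies_def b_def)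
    ultimately have "\<bar>(\<Sum>j<k. w j * real (c (map (\<tau> j) d) i)) -
        (\<Sum>j<k. w j * real (c (map (\<tau> j) (map \<sigma> d)) i))\<bar> \<le> \<epsilon>"
      using i(1) by (rule ramsey[rule_format])
    moreover have "(\<Sum>j<k. w j * real (c (map (\<tau> j) d) i)) =
        (\<Sum>j<k. w j * indicator (def_set L M a \<phi>) (x j))"
      using ind1 i by (intro sum.cong) auto
    moreover have "(\<Sum>j<k. w j * real (c (map (\<tau> j) (map \<sigma> d)) i)) =
        (\<Sum>j<k. w j * indicator (def_set L M a (param_fm \<sigma> \<phi>)) (x j))"
      using ind2[OF _ i(1) \<sigma>] i(2) by (intro sum.cong) auto
    ultimately show ?thesis by simp
  qed
  then show ?thesis using w x(1) by blast
qed

text \<open>Tychonoff's theorem, since the topology on the function type is the product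
  topology.\<close>

lemma compact_unit_functions: "compact {m :: 'a \<Rightarrow> real. \<forall>A. m A \<in> {0..1}}"
proof -
  have "compactin (product_topology (\<lambda>_. euclidean) UNIV) (PiE (UNIV :: 'a set) (\<lambda>_. {0..1::real}))"
    by (simp add: compactin_PiE)
  moreover have "PiE (UNIV :: 'a set) (\<lambda>_. {0..1::real}) = {m. \<forall>A. m A \<in> {0..1}}"
    by (auto simp: PiE_def Pi_def)
  ultimately show ?thesis by (simp add: euclidean_product_topology)
qed

text \<open>Invariant contents form an intersection of closed sets in a compact cube. Finitely many
  of the conditions involve finitely many formulas, automorphisms and tolerances, and
  \<open>DEECRP_approx\<close> meets them by a finite combination of point masses.\<close>

lemma DEECRP_invariant_content:
  fixes L :: "('f, 'r) language" and M :: "('f, 'r, 'm) fo_struct"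
  assumes M: "is_struct L M" and ram: "DEECRP L M" and a: "set a \<subseteq> dom M"
  shows "\<exists>m :: 'm list set \<Rightarrow> real. (\<forall>A. 0 \<le> m A) \<and> m (copies L M (dom M) a) = 1 \<and>
    (\<forall>A B. A \<inter> B = {} \<longrightarrow> m (A \<union> B) = m A + m B) \<and>
    (\<forall>\<phi>\<in>formulas (lang_over L (dom M)) (length a). \<forall>\<sigma>\<in>Aut L M.
       m (def_set L M a (param_fm \<sigma> \<phi>)) = m (def_set L M a \<phi>))"
proof -
  let ?X = "copies L M (dom M) a" and ?fm = "formulas (lang_over L (dom M)) (length a)"
  let ?D = "\<lambda>\<phi>. def_set L M a \<phi>"
  \<comment> \<open>Finitely additive probabilities on all sets of tuples. Each condition concerns
    at most three coordinates of \<open>m\<close> and is therefore closed.\<close>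
  define K where "K = {m :: 'm list set \<Rightarrow> real. \<forall>A. m A \<in> {0..1}} \<inter>
    ({m. m ?X = 1} \<inter> (\<Inter>(A, B)\<in>{(A, B). A \<inter> B = {}}. {m. m (A \<union> B) = m A + m B}))"
  have "closed {m :: 'm list set \<Rightarrow> real. m ?X = 1}"
    "closed {m :: 'm list set \<Rightarrow> real. m (A \<union> B) = m A + m B}" for A B
    by (intro closed_Collect_eq continuous_intros continuous_on_product_coordinates)+
  then have K: "compact K" unfolding K_def
    by (intro compact_Int_closed compact_unit_functions closed_Int closed_INT) auto
  \<comment> \<open>Invariance is split into closed conditions with positive tolerance
    \<open>e\<close>, because approximate invariance is what \<open>DEECRP\<close> provides.\<close>
  define I where "I = ?fm \<times> Aut L M \<times> {e::real. 0 < e}"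
  define G where "G = (\<lambda>(\<phi>, \<sigma>, e). {m :: 'm list set \<Rightarrow> real. \<bar>m (?D \<phi>) - m (?D (param_fm \<sigma> \<phi>))\<bar> \<le> e})"
  have "K \<inter> (\<Inter>i\<in>I. G i) \<noteq> {}"
  proof (rule compact_imp_fip_image[OF K])
    show "closed (G i)" for i
      unfolding G_def
     
        by (auto split: prod.split intro!: closed_Collect_le continuous_intros continuous_on_product_coordinates)
    fix I' assume I': "finite I'" "I' \<subseteq> I"
    define \<Phi> where "\<Phi> = fst ` I'"
    define S where "S = (fst \<circ> snd) ` I'"
    \<comment> \<open>The least of the finitely many tolerances; the entry 1 keeps the minimum
      defined when \<open>I'\<close> is empty.\<close>
    define e where "e = Min (insert 1 ((snd \<circ> snd) ` I'))"
    have e: "0 < e" "\<And>i. i \<in> I' \<Longrightarrow> e \<le> snd (snd i)" using I' by (auto simp: e_def I_def)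
    have "convex_ramsey e L M" using ram e by (simp add: DEECRP_def)
    moreover have "finite \<Phi>" "\<Phi> \<subseteq> ?fm" "finite S" "S \<subseteq> Aut L M"
      using I' by (auto simp: \<Phi>_def S_def I_def)
    ultimately obtain k w x where w: "\<forall>j<k. w j \<in> {0..1::real}" "(\<Sum>j<(k::nat). w j) = 1"
      and x: "\<forall>j<k. x j \<in> ?X"
      and close: "\<forall>\<phi>\<in>\<Phi>. \<forall>\<sigma>\<in>S. \<bar>(\<Sum>j<k. w j * indicator (?D \<phi>) (x j)) -
       (\<Sum>j<k. w j * indicator (?D (param_fm \<sigma> \<phi>)) (x j))\<bar> \<le> e"
      using DEECRP_approx[OF M _ a, of e \<Phi> S] by blast
    \<comment> \<open>The convex combination of the point masses at the \<open>x j\<close>.\<close>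
    define m where "m A = (\<Sum>j<k. w j * indicator A (x j))" for A
    have "0 \<le> m A" for A unfolding m_def using w by (intro sum_nonneg) auto
    moreover have "m A \<le> 1" for A
    proof -
      have "m A \<le> (\<Sum>j<k. w j)" unfolding m_def using w
        by (intro sum_mono) (auto simp: indicator_def)
      then show ?thesis using w by simp
    qed
    moreover have "m ?X = 1" using w x by (simp add: m_def)
    moreover have "m (A \<union> B) = m A + m B" if "A \<inter> B = {}" for A B
    proof -
      have "indicator (A \<union> B) z = indicator A z + (indicator B z :: real)" for z
        using that by (auto simp: indicator_def)
      then show ?thesis unfolding m_def by (simp only: distrib_left sum.distrib)
    qed
    ultimately have "m \<in> K" unfolding K_def by auto
    moreover have "m \<in> G i" if "i \<in> I'" for i
    proof -
      obtain \<phi> \<sigma> r where i: "i = (\<phi>, \<sigma>, r)" using prod_cases3 by blast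
      have "\<phi> \<in> \<Phi>" "\<sigma> \<in> S" using that i by (force simp: \<Phi>_def S_def)+
      then have "\<bar>m (?D \<phi>) - m (?D (param_fm \<sigma> \<phi>))\<bar> \<le> e" using close by (simp add: m_def)
      moreover have "e \<le> r" using e(2)[OF that] i by simp
      ultimately show ?thesis by (simp add: G_def i)
    qed
    ultimately show "K \<inter> (\<Inter>i\<in>I'. G i) \<noteq> {}" by blast
  qed
  then obtain m where m: "m \<in> K" "\<And>i. i \<in> I \<Longrightarrow> m \<in> G i" by blast
  have "m (?D (param_fm \<sigma> \<phi>)) = m (?D \<phi>)" if "\<phi> \<in> ?fm" "\<sigma> \<in> Aut L M" for \<phi> \<sigma>
  proof -
    have "\<bar>m (?D \<phi>) - m (?D (param_fm \<sigma> \<phi>))\<bar> \<le> 0 + e" if "0 < e" for e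
      using m(2)[of "(\<phi>, \<sigma>, e)"] that \<open>\<phi> \<in> ?fm\<close> \<open>\<sigma> \<in> Aut L M\<close> by (simp add: I_def G_def)
    then have "\<bar>m (?D \<phi>) - m (?D (param_fm \<sigma> \<phi>))\<bar> \<le> 0" by (rule field_le_epsilon)
    then show ?thesis by simp
  qed
  moreover have "(\<forall>A. 0 \<le> m A) \<and> m ?X = 1 \<and> (\<forall>A B. A \<inter> B = {} \<longrightarrow> m (A \<union> B) = m A + m B)"
    using m(1) by (auto simp: K_def)
  ultimately show ?thesis by blast
qed

lemma DEECRP_imp_amenable:
  assumes mon: "monster_model L T \<kappa> M" and ram: "DEECRP L M"
  shows "amenable L M"
  unfolding amenable_def
proof (intro allI ballI)
  fix n p assume p: "p \<in> types L M n {}"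
  have M: "is_struct L M" using mon by (simp add: monster_model_def is_model_def)
  obtain a where a: "length a = n" "set a \<subseteq> dom M" "tp L M {} a = p"
    using monster_realize[OF mon p] by auto
  let ?X = "copies L M (dom M) a" and ?fm = "formulas (lang_over L (dom M)) n"
  let ?D = "\<lambda>\<phi>. def_set L M a \<phi>"
  obtain m where m0: "\<And>A. 0 \<le> m A" and m1: "m ?X = (1::real)"
    and mUn: "\<And>A B. A \<inter> B = {} \<Longrightarrow> m (A \<union> B) = m A + m B"
    and minv: "\<And>\<phi> \<sigma>. \<phi> \<in> ?fm \<Longrightarrow> \<sigma> \<in> Aut L M \<Longrightarrow> m (?D (param_fm \<sigma> \<phi>)) = m (?D \<phi>)"
    using DEECRP_invariant_content[OF M ram a(2)] a(1) by blast
  \<comment> \<open>The image of \<open>m\<close> under the map that sends a copy of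
    \<open>a\<close> to its type over the whole model. By \<open>basicD\<close> below, basic sets
    pull back to definable sets, where \<open>m\<close> is invariant.\<close>
  define f where "f A = ennreal (m {x\<in>?X. tp L M (dom M) x \<in> A})" for A
  have tpX: "tp L M (dom M) x \<in> global_types L M n p" if x: "x \<in> ?X" for x
  proof -
    have xd: "set x \<subseteq> dom M" "length x = n" "tp L M {} x = p" using x a by (auto simp: copies_def)
    have "tp L M {} x \<subseteq> tp L M (dom M) x"
      using formulas_mono[of "{}" "dom M" L "length x"] by (auto simp: tp_def)
    then show ?thesis using tp_types[OF xd(1), of L "dom M"] xd by (simp add: global_types_def)
  qed
  have basicD: "{x\<in>?X. tp L M (dom M) x \<in> basic L M n p \<phi>} = ?D \<phi>" if "\<phi> \<in> ?fm" for \<phi>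
  proof -
    have "tp L M (dom M) x \<in> basic L M n p \<phi> \<longleftrightarrow> holds (struct_over M) \<phi> x" if x: "x \<in> ?X" for x
      using tpX[OF x] x \<open>\<phi> \<in> ?fm\<close> a(1) by (simp add: basic_def tp_def copies_def)
    then show ?thesis by blast
  qed
  interpret S: stone_content "type_space L M n p" "basics L M n p" f
  proof (intro stone_content.intro stone_content_axioms.intro)
    show "algebra (topspace (type_space L M n p)) (basics L M n p)"
      unfolding topspace_type_space by (rule algebra_basics)
    show "compact_space (type_space L M n p)" by (rule compact_type_space[OF p])
    show "openin (type_space L M n p) A" if "A \<in> basics L M n p" for A
      using that openin_basic by blast
    show "\<exists>A\<in>basics L M n p. x \<in> A \<and> A \<subseteq> U" if "openin (type_space L M n p) U" "x \<in> U" for U x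
      using type_space_base[OF that] .
    show "f {} = 0" using mUn[of "{}" "{}"] by (simp add: f_def)
    show "f (A \<union> B) = f A + f B" if "A \<inter> B = {}" for A B
    proof -
      have "{x\<in>?X. tp L M (dom M) x \<in> A \<union> B} =
          {x\<in>?X. tp L M (dom M) x \<in> A} \<union> {x\<in>?X. tp L M (dom M) x \<in> B}" by auto
      moreover have "{x\<in>?X. tp L M (dom M) x \<in> A} \<inter> {x\<in>?X. tp L M (dom M) x \<in> B} = {}"
        using that by auto
      ultimately show ?thesis using mUn m0 by (simp add: f_def ennreal_plus)
    qed
    have "{x\<in>?X. tp L M (dom M) x \<in> global_types L M n p} = ?X" using tpX by auto
    then show "f (topspace (type_space L M n p)) = 1" by (simp add: f_def topspace_type_space m1)
  qed
  have "emeasure S.borel_extension (act \<sigma> ` B) = emeasure S.borel_extension B"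
    if \<sigma>: "\<sigma> \<in> Aut L M" and B: "B \<in> sets S.borel_extension" for \<sigma> B
  proof (rule S.emeasure_borel_extension_image[OF _ _ _ _ B])
    let ?\<tau> = "inv_into (dom M) \<sigma>"
    have \<tau>: "?\<tau> \<in> Aut L M" by (rule Aut_inv[OF M \<sigma>])
    have pf: "param_fm \<rho> \<phi> \<in> ?fm" if "\<rho> \<in> Aut L M" "\<phi> \<in> ?fm" for \<rho> \<phi>
      using param_formulas[OF that(2), of \<rho>] that(1) by (simp add: Aut_def bij_betw_def)
    show "bij_betw (act \<sigma>) (topspace (type_space L M n p)) (topspace (type_space L M n p))"
      unfolding topspace_type_space by (rule bij_betw_act[OF M \<sigma> p])
    fix A assume "A \<in> basics L M n p"
    then obtain \<phi> where \<phi>: "\<phi> \<in> ?fm" "A = basic L M n p \<phi>" by auto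
    have im: "act \<sigma> ` A = basic L M n p (param_fm \<sigma> \<phi>)" using act_basic[OF M \<sigma> p \<phi>(1)] \<phi>(2) by simp
    show "act \<sigma> ` A \<in> basics L M n p" unfolding im using pf[OF \<sigma> \<phi>(1)] by (rule imageI)
    have "f (act \<sigma> ` A) = ennreal (m (?D (param_fm \<sigma> \<phi>)))"
      unfolding im f_def basicD[OF pf[OF \<sigma> \<phi>(1)]] ..
    also have "\<dots> = f A" unfolding \<phi>(2) f_def basicD[OF \<phi>(1)] minv[OF \<phi>(1) \<sigma>] ..
    finally show "f (act \<sigma> ` A) = f A" .
    \<comment> \<open>Every clopen set is an image under \<open>act \<sigma>\<close>, namely of its
      own translate by the inverse.\<close>
    have "act \<sigma> (act ?\<tau> q) = q" if "q \<in> A" for q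
      using act_act_inv(1)[OF \<sigma>, of q n p] that \<phi>(2) by (simp add: basic_def)
    then have "A = act \<sigma> ` act ?\<tau> ` A" by (simp add: image_image)
    moreover have "act ?\<tau> ` A \<in> basics L M n p"
      using act_basic[OF M \<tau> p \<phi>(1)] \<phi>(2) pf[OF \<tau> \<phi>(1)] by simp
    ultimately show "\<exists>A'\<in>basics L M n p. A = act \<sigma> ` A'" by blast
  qed
  then show "\<exists>\<mu>. regular_borel_prob (type_space L M n p) \<mu> \<and>
      (\<forall>\<sigma>\<in>Aut L M. \<forall>B\<in>sets \<mu>. emeasure \<mu> (act \<sigma> ` B) = emeasure \<mu> B)"
    using S.regular_borel_prob_borel_extension by blast
qed

section \<open>The equivalence of the three properties\<close>

theorem theorem3p28:
  fixes L :: "('f, 'r) language"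
    and T :: "('f, 'r) fm set"
    and \<kappa> :: "'k rel"
    and \<CC> :: "('f, 'r, 'm) fo_struct"
  assumes "complete_theory L T"
    and "monster_model L T \<kappa> \<CC>"
  shows "(amenable L \<CC> \<longleftrightarrow> DEECRP L \<CC>) \<and> (DEECRP L \<CC> \<longleftrightarrow> strong_DEECRP L \<CC>)"
proof -
  have "strong_DEECRP L \<CC> \<Longrightarrow> DEECRP L \<CC>"
    by (auto simp: DEECRP_def strong_DEECRP_def intro: convex_ramsey_mono)
  then show ?thesis
    using amenable_imp_strong_DEECRP[OF assms(2)] DEECRP_imp_amenable[OF assms(2)] by blast
qed

end
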